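(* Let $$v=\begin{pmatrix} q^{-3}x_1 & q^{-2}x_2\\ -q^{-1}\bar x^2 & q^{-1}\bar x^1\\ q^{-1}x_3 & -x_4\\ -\bar x^4 & -\bar x^3\end{pmatrix},$$ a matrix with entries in $A(S^7_q)$ which satisfies $v^*v=1$, so that $p=vv^*\in M_4(A(S^7_q))$ is a self-adjoint idempotent. Then the entries of the projection $p$ generate a subalgebra of $A(S^7_q)$ which is a deformation of the algebra of polynomial functions on the $4$-sphere $S^4$.
   Context: Fix $q\in\mathbb{R}$, $q\neq 0$; algebras are unital and over $\mathbb{C}$. For $i\in\{1,2,3,4\}$ put $i'=5-i$, $(\varepsilon_1,\varepsilon_2,\varepsilon_3,\varepsilon_4)=(1,1,-1,-1)$, $(\rho_1,\rho_2,\rho_3,\rho_4)=(2,1,-1,-2)$. Let $e_i^{\,j}\in M_4(\mathbb{C})$ be the matrix unit with $1$ in row $i$, column $j$, and let $$R=q\sum_{i}e_i^{\,i}\otimes e_i^{\,i}+\sum_{i\neq j,j'}e_i^{\,i}\otimes e_j^{\,j}+q^{-1}\sum_i e_{i'}^{\,i'}\otimes e_i^{\,i}+(q-q^{-1})\sum_{i>j}e_i^{\,j}\otimes e_j^{\,i}-(q-q^{-1})\sum_{i>j}q^{\rho_i-\rho_j}\varepsilon_i\varepsilon_j\,e_i^{\,j}\otimes e_{i'}^{\,j'},$$ with $i,j$ ranging over $1,\dots,4$. Let $C$ be the matrix $C_i^{\,j}=q^{\rho_j}\varepsilon_i\delta_{ij'}$. $A(Sp_q(2))$ is the algebra generated by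 the entries $T_i^{\,j}$ (row $i$, column $j$, $1\le i,j\le 4$) of a matrix $T$ with relations $R\,T_1T_2=T_2T_1R$ (where $T_1=T\otimes 1$, $T_2=1\otimes T$), and $TCT^tC^{-1}=CT^tC^{-1}T=1$. It is a Hopf $*$-algebra with $\Delta(T_i^{\,j})=\sum_kT_i^{\,k}\otimes T_k^{\,j}$, $\varepsilon(T_i^{\,j})=\delta_{ij}$, $S(T)=CT^tC^{-1}$, i.e. $S(T)_i^{\,j}=-q^{\rho_{i'}+\rho_j}\varepsilon_i\varepsilon_{j'}T_{j'}^{\,i'}$, and antilinear anti-involution (denoted by a bar) $\overline{T}=S(T)^t$, i.e. $\overline{T_i^{\,j}}=S(T)_j^{\,i}$. $A(S^7_q)$ is the subalgebra of $A(Sp_q(2))$ generated by $x_i=T_i^{\,4}$ and $\bar x^i=\overline{x_i}=S(T)_4^{\,i}=q^{2+\rho_i}\varepsilon_{i'}T_{i'}^{\,1}$, $i=1,\dots,4$; one has $\sum_i\bar x^ix_i=1$. For a matrix $v$ over $A(S^7_q)$, $v^*$ denotes the conjugate transpose. "Deformation of the algebra of polynomial functions on $S^4$" means a family of algebras depending on the parameter $q$ which for $q=1$ reduces to the commutative $*$-algebra of complex polynomial functions on $S^4$, i.e. $\mathbb{C}[y_0,\dots,y_4]/(\sum_iy_i^2-1)$ with $y_i=y_i^*$. *)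

theory Defs
  imports
    "HOL-Analysis.Determinants"
    "HOL-Library.Poly_Mapping"
    "HOL-Library.Numeral_Type"
    "HOL-Algebra.QuotRing"
    "HOL-Algebra.Module"
    "HOL-Algebra.Subrings"
begin

section \<open>Unital complex *-algebras\<close>

record 'a star_alg = "(complex, 'a) module" +
  star :: "'a \<Rightarrow> 'a"

definition complex_ring :: "complex ring" where
  "complex_ring = \<lparr>carrier = UNIV, mult = (*), one = 1, zero = 0, add = (+)\<rparr>"

locale star_algebra = module complex_ring A + ring A
  for A :: "('a, 'm) star_alg_scheme" (structure) +
  assumes smult_mult_left:
      "\<lbrakk>x \<in> carrier A; y \<in> carrier A\<rbrakk> \<Longrightarrow> (c \<odot> x) \<otimes> y = c \<odot> (x \<otimes> y)"
    and smult_mult_right: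
      "\<lbrakk>x \<in> carrier A; y \<in> carrier A\<rbrakk> \<Longrightarrow> x \<otimes> (c \<odot> y) = c \<odot> (x \<otimes> y)"
    and star_closed: "x \<in> carrier A \<Longrightarrow> star A x \<in> carrier A"
    and star_star: "x \<in> carrier A \<Longrightarrow> star A (star A x) = x"
    and star_add:
      "\<lbrakk>x \<in> carrier A; y \<in> carrier A\<rbrakk> \<Longrightarrow> star A (x \<oplus> y) = star A x \<oplus> star A y"
    and star_smult: "x \<in> carrier A \<Longrightarrow> star A (c \<odot> x) = cnj c \<odot> star A x"
    and star_mult:
      "\<lbrakk>x \<in> carrier A; y \<in> carrier A\<rbrakk> \<Longrightarrow> star A (x \<otimes> y) = star A y \<otimes> star A x"

definition unital_subalgebra :: "'a set \<Rightarrow> ('a, 'm) star_alg_scheme \<Rightarrow> bool" where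
  "unital_subalgebra B A \<longleftrightarrow> B \<subseteq> carrier A \<and> subring B A \<and> (\<forall>c. \<forall>x\<in>B. c \<odot>\<^bsub>A\<^esub> x \<in> B)"

text \<open>Only the algebra operations are used for generation; that the result is closed under
  the involution is a property of the generating set.\<close>

definition generated_subalgebra ::
    "('a, 'm) star_alg_scheme \<Rightarrow> 'a set \<Rightarrow> ('a, 'm) star_alg_scheme" where
  "generated_subalgebra A S = A\<lparr>carrier := \<Inter>{B. unital_subalgebra B A \<and> S \<subseteq> B}\<rparr>"

definition star_isomorphic ::
    "('a, 'm) star_alg_scheme \<Rightarrow> ('b, 'n) star_alg_scheme \<Rightarrow> bool" where
  "star_isomorphic A B \<longleftrightarrow> (\<exists>h \<in> ring_iso A B.
     (\<forall>c. \<forall>x\<in>carrier A. h (c \<odot>\<^bsub>A\<^esub> x) = c \<odot>\<^bsub>B\<^esub> h x) \<and>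
     (\<forall>x\<in>carrier A. h (star A x) = star B (h x)))"

text \<open>For an ideal \<open>I\<close> stable under the involution, the image \<open>star A ` X\<close> of a coset is again
  a coset. For \<open>c \<noteq> 0\<close> the set \<open>c X\<close> is already a coset; adding \<open>I\<close> also covers \<open>c = 0\<close>.\<close>

definition star_quot :: "('a, 'm) star_alg_scheme \<Rightarrow> 'a set \<Rightarrow> 'a set star_alg" where
  "star_quot A I =
     \<lparr>carrier = carrier (A Quot I), mult = mult (A Quot I), one = one (A Quot I),
      zero = zero (A Quot I), add = add (A Quot I),
      smult = (\<lambda>c X. I <+>\<^bsub>A\<^esub> (\<lambda>x. c \<odot>\<^bsub>A\<^esub> x) ` X),
      star = (\<lambda>X. star A ` X)\<rparr>"

subsection \<open>Matrices over a *-algebra\<close>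

definition mat_mult ::
    "('a, 'm) star_alg_scheme \<Rightarrow> ('i \<Rightarrow> 'k::finite \<Rightarrow> 'a) \<Rightarrow> ('k \<Rightarrow> 'j \<Rightarrow> 'a) \<Rightarrow> 'i \<Rightarrow> 'j \<Rightarrow> 'a" where
  "mat_mult A M N = (\<lambda>i j. \<Oplus>\<^bsub>A\<^esub>k\<in>UNIV. M i k \<otimes>\<^bsub>A\<^esub> N k j)"

definition mat_star ::
    "('a, 'm) star_alg_scheme \<Rightarrow> ('i \<Rightarrow> 'j \<Rightarrow> 'a) \<Rightarrow> 'j \<Rightarrow> 'i \<Rightarrow> 'a" where
  "mat_star A M = (\<lambda>j i. star A (M i j))"

definition mat_one :: "('a, 'm) star_alg_scheme \<Rightarrow> 'i \<Rightarrow> 'i \<Rightarrow> 'a" where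
  "mat_one A = (\<lambda>i j. if i = j then \<one>\<^bsub>A\<^esub> else \<zero>\<^bsub>A\<^esub>)"

section \<open>Free *-algebras and polynomial *-algebras\<close>

text \<open>The convolution algebra \<open>'m \<Rightarrow>\<^sub>0 complex\<close> of a monoid is the free algebra when \<open>'m\<close>
  is a free monoid and the polynomial algebra when \<open>'m = 'i \<Rightarrow>\<^sub>0 nat\<close>.\<close>

definition const :: "complex \<Rightarrow> ('m::zero \<Rightarrow>\<^sub>0 complex)" where
  "const c = Poly_Mapping.single 0 c"

definition monoid_star_alg ::
    "(('m::monoid_add \<Rightarrow>\<^sub>0 complex) \<Rightarrow> ('m \<Rightarrow>\<^sub>0 complex)) \<Rightarrow> ('m \<Rightarrow>\<^sub>0 complex) star_alg" where
  "monoid_star_alg s =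
     \<lparr>carrier = UNIV, mult = (*), one = 1, zero = 0, add = (+),
      smult = (\<lambda>c f. const c * f), star = s\<rparr>"

datatype 'x free_monoid = Word (letters: "'x list")

instantiation free_monoid :: (type) monoid_add
begin
definition "0 = Word []"
definition "u + w = Word (letters u @ letters w)"
instance by standard (simp_all add: zero_free_monoid_def plus_free_monoid_def)
end

type_synonym 'x free_alg = "'x free_monoid \<Rightarrow>\<^sub>0 complex"

definition gen :: "'x \<Rightarrow> 'x free_alg" where
  "gen x = Poly_Mapping.single (Word [x]) 1"

text \<open>The antilinear anti-endomorphism of the free algebra with \<open>gen x \<mapsto> s x\<close>.\<close>

definition free_star :: "('x \<Rightarrow> 'x free_alg) \<Rightarrow> 'x free_alg \<Rightarrow> 'x free_alg" where
  "free_star s f = (\<Sum>w\<in>Poly_Mapping.keys f.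
     const (cnj (Poly_Mapping.lookup f w)) * prod_list (map s (rev (letters w))))"

section \<open>The quantum symplectic group\<close>

datatype idx = I1 | I2 | I3 | I4

lemma UNIV_idx: "UNIV = {I1, I2, I3, I4}"
  using idx.exhaust by auto

instance idx :: finite
  by standard (simp add: UNIV_idx)

fun pos :: "idx \<Rightarrow> nat" where
  "pos I1 = 1" | "pos I2 = 2" | "pos I3 = 3" | "pos I4 = 4"

fun prime_idx :: "idx \<Rightarrow> idx" where
  "prime_idx I1 = I4" | "prime_idx I2 = I3" | "prime_idx I3 = I2" | "prime_idx I4 = I1"

fun sgn_idx :: "idx \<Rightarrow> real" where
  "sgn_idx I1 = 1" | "sgn_idx I2 = 1" | "sgn_idx I3 = -1" | "sgn_idx I4 = -1"

fun rho :: "idx \<Rightarrow> int" where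
  "rho I1 = 2" | "rho I2 = 1" | "rho I3 = -1" | "rho I4 = -2"

lemma pos_prime_idx: "pos (prime_idx i) = 5 - pos i"
  by (cases i) simp_all

definition unit_mat :: "idx \<Rightarrow> idx \<Rightarrow> real^idx^idx" where
  "unit_mat i j = (\<chi> a b. if a = i \<and> b = j then 1 else 0)"

text \<open>Kronecker product: rows and columns are indexed by pairs, the first component belonging
  to the left factor.\<close>

definition kron :: "'a::times^idx^idx \<Rightarrow> 'a^idx^idx \<Rightarrow> 'a^(idx \<times> idx)^(idx \<times> idx)" where
  "kron M N = (\<chi> r s. M $ fst r $ fst s * N $ snd r $ snd s)"

definition R_mat :: "real \<Rightarrow> real^(idx \<times> idx)^(idx \<times> idx)" where
  "R_mat q =
     q *\<^sub>R (\<Sum>i\<in>UNIV. kron (unit_mat i i) (unit_mat i i))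
   + (\<Sum>(i, j) | i \<noteq> j \<and> i \<noteq> prime_idx j. kron (unit_mat i i) (unit_mat j j))
   + (q powi -1) *\<^sub>R (\<Sum>i\<in>UNIV. kron (unit_mat (prime_idx i) (prime_idx i)) (unit_mat i i))
   + (q - q powi -1) *\<^sub>R (\<Sum>(i, j) | pos i > pos j. kron (unit_mat i j) (unit_mat j i))
   - (q - q powi -1) *\<^sub>R (\<Sum>(i, j) | pos i > pos j.
       (q powi (rho i - rho j) * sgn_idx i * sgn_idx j) *\<^sub>R
         kron (unit_mat i j) (unit_mat (prime_idx i) (prime_idx j)))"

definition C_mat :: "real \<Rightarrow> real^idx^idx" where
  "C_mat q = (\<chi> i j. if i = prime_idx j then q powi rho j * sgn_idx i else 0)"

definition C_inv :: "real \<Rightarrow> real^idx^idx" where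
  "C_inv q = - C_mat q"

lemma C_mat_inverse:
  assumes "q \<noteq> 0"
  shows "C_mat q ** C_inv q = mat 1" "C_inv q ** C_mat q = mat 1"
proof -
  have "(C_mat q ** C_inv q) $ i $ j = mat 1 $ i $ j" for i j
    using assms by (cases i; cases j)
      (simp_all add: C_mat_def C_inv_def matrix_matrix_mult_def mat_def UNIV_idx power_int_minus)
  then show "C_mat q ** C_inv q = mat 1"
    by (simp add: vec_eq_iff)
  then show "C_inv q ** C_mat q = mat 1"
    using matrix_left_right_inverse by blast
qed

type_synonym sp_free = "(idx \<times> idx) free_alg"

definition T_mat :: "sp_free^idx^idx" where
  "T_mat = (\<chi> i j. gen (i, j))"

definition lift_mat :: "real^'m^'n \<Rightarrow> sp_free^'m::finite^'n::finite" where
  "lift_mat = map_matrix (\<lambda>r. const (complex_of_real r))"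

definition T1_mat :: "sp_free^(idx \<times> idx)^(idx \<times> idx)" where
  "T1_mat = kron T_mat (mat 1)"

definition T2_mat :: "sp_free^(idx \<times> idx)^(idx \<times> idx)" where
  "T2_mat = kron (mat 1) T_mat"

definition ST_mat :: "real \<Rightarrow> sp_free^idx^idx" where
  "ST_mat q = lift_mat (C_mat q) ** transpose T_mat ** lift_mat (C_inv q)"

lemma ST_mat_entry:
  assumes "q \<noteq> 0"
  shows "ST_mat q $ i $ j =
    const (complex_of_real
      (- (q powi (rho (prime_idx i) + rho j)) * sgn_idx i * sgn_idx (prime_idx j)))
    * gen (prime_idx j, prime_idx i)"
  using assms
  by (cases i; cases j)
    (simp_all add: ST_mat_def lift_mat_def C_mat_def C_inv_def T_mat_def gen_def const_def
      matrix_matrix_mult_def transpose_def UNIV_idx mult_single zero_free_monoid_def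
      plus_free_monoid_def single_uminus power_int_def field_simps power2_eq_square power3_eq_cube
      eval_nat_numeral)

definition sp_relations :: "real \<Rightarrow> sp_free set" where
  "sp_relations q =
     {(lift_mat (R_mat q) ** T1_mat ** T2_mat - T2_mat ** T1_mat ** lift_mat (R_mat q)) $ r $ s
        | r s. True}
   \<union> {(T_mat ** ST_mat q - mat 1) $ i $ j | i j. True}
   \<union> {(ST_mat q ** T_mat - mat 1) $ i $ j | i j. True}"

text \<open>The involution of the free algebra determined by \<open>T\<^sub>i\<^sup>j \<mapsto> S(T)\<^sub>j\<^sup>i\<close>.\<close>

definition sp_free_alg :: "real \<Rightarrow> sp_free star_alg" where
  "sp_free_alg q = monoid_star_alg (free_star (\<lambda>(i, j). ST_mat q $ j $ i))"

definition sp_ideal :: "real \<Rightarrow> sp_free set" where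
  "sp_ideal q = Idl\<^bsub>sp_free_alg q\<^esub> (sp_relations q)"

definition A_Sp :: "real \<Rightarrow> sp_free set star_alg" where
  "A_Sp q = star_quot (sp_free_alg q) (sp_ideal q)"

definition T_gen :: "real \<Rightarrow> idx \<Rightarrow> idx \<Rightarrow> sp_free set" where
  "T_gen q i j = sp_ideal q +>\<^bsub>sp_free_alg q\<^esub> (T_mat $ i $ j)"

section \<open>The quantum seven-sphere and four-sphere\<close>

definition x_gen :: "real \<Rightarrow> idx \<Rightarrow> sp_free set" where
  "x_gen q i = T_gen q i I4"

definition xbar_gen :: "real \<Rightarrow> idx \<Rightarrow> sp_free set" where
  "xbar_gen q i = star (A_Sp q) (x_gen q i)"

definition A_S7 :: "real \<Rightarrow> sp_free set star_alg" where
  "A_S7 q = generated_subalgebra (A_Sp q) (range (x_gen q) \<union> range (xbar_gen q))"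

datatype col = Col1 | Col2

lemma UNIV_col: "UNIV = {Col1, Col2}"
  using col.exhaust by auto

instance col :: finite
  by standard (simp add: UNIV_col)

abbreviation scale_S7 :: "real \<Rightarrow> real \<Rightarrow> sp_free set \<Rightarrow> sp_free set" where
  "scale_S7 q r X \<equiv> complex_of_real r \<odot>\<^bsub>A_S7 q\<^esub> X"

fun v_mat :: "real \<Rightarrow> idx \<Rightarrow> col \<Rightarrow> sp_free set" where
  "v_mat q I1 Col1 = scale_S7 q (q powi -3) (x_gen q I1)"
| "v_mat q I1 Col2 = scale_S7 q (q powi -2) (x_gen q I2)"
| "v_mat q I2 Col1 = scale_S7 q (- (q powi -1)) (xbar_gen q I2)"
| "v_mat q I2 Col2 = scale_S7 q (q powi -1) (xbar_gen q I1)"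
| "v_mat q I3 Col1 = scale_S7 q (q powi -1) (x_gen q I3)"
| "v_mat q I3 Col2 = scale_S7 q (-1) (x_gen q I4)"
| "v_mat q I4 Col1 = scale_S7 q (-1) (xbar_gen q I4)"
| "v_mat q I4 Col2 = scale_S7 q (-1) (xbar_gen q I3)"

definition p_mat :: "real \<Rightarrow> idx \<Rightarrow> idx \<Rightarrow> sp_free set" where
  "p_mat q = mat_mult (A_S7 q) (v_mat q) (mat_star (A_S7 q) (v_mat q))"

definition A_S4 :: "real \<Rightarrow> sp_free set star_alg" where
  "A_S4 q = generated_subalgebra (A_S7 q) {p_mat q i j | i j. True}"

section \<open>Polynomial functions on the four-sphere and deformations\<close>

type_synonym poly5 = "(5 \<Rightarrow>\<^sub>0 nat) \<Rightarrow>\<^sub>0 complex"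

definition y_var :: "5 \<Rightarrow> poly5" where
  "y_var k = Poly_Mapping.single (Poly_Mapping.single k 1) 1"

text \<open>Conjugating coefficients is the involution for which every \<open>y_var k\<close> is self-adjoint.\<close>

definition poly5_alg :: "poly5 star_alg" where
  "poly5_alg = monoid_star_alg (Poly_Mapping.map cnj)"

definition Pol_S4 :: "poly5 set star_alg" where
  "Pol_S4 = star_quot poly5_alg (Idl\<^bsub>poly5_alg\<^esub> {(\<Sum>k\<in>UNIV. y_var k ^ 2) - 1})"

text \<open>A deformation of \<open>B\<close> is a family of *-algebras, indexed by the nonzero reals, whose member
  at the parameter value \<open>1\<close> is \<open>B\<close>.\<close>

definition is_deformation ::
    "(real \<Rightarrow> ('a, 'm) star_alg_scheme) \<Rightarrow> ('b, 'n) star_alg_scheme \<Rightarrow> bool" where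
  "is_deformation A B \<longleftrightarrow>
     (\<forall>q. q \<noteq> 0 \<longrightarrow> star_algebra (A q)) \<and> star_isomorphic (A 1) B"

end

theory Submission
  imports Defs "HOL-Computational_Algebra.Polynomial"
begin

text \<open>
  For \<open>q \<noteq> 0\<close> the rule \<open>T\<^sub>i\<^sup>j \<mapsto> S(T)\<^sub>j\<^sup>i\<close> defines an antilinear involution of the free algebra. It preserves
  the ideal of relations of the quantum symplectic group: the relations \<open>TS = ST = 1\<close> are permuted,
  and \<open>R T\<^sub>1 T\<^sub>2 = T\<^sub>2 T\<^sub>1 R\<close> is sent to \<open>S\<^sub>1 S\<^sub>2 R = R S\<^sub>2 S\<^sub>1\<close>, because the transpose of \<open>R\<close> is its flip
  (\<open>R_mat_flip_transpose\<close>), and the latter identity is the former one multiplied by the inverses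
  of \<open>T\<^sub>1\<close> and \<open>T\<^sub>2\<close> on both sides (\<open>RSS_cong\<close>). So the quotient is a *-algebra, and so are its
  subalgebras generated by *-stable sets.

  The identity \<open>v\<^sup>* v = 1\<close> is a reordering. The column of \<open>R\<close> with index \<open>(4,1)\<close> has a single nonzero
  entry, so the corresponding quadratic relations rewrite each product \<open>T\<^sub>j\<^sup>1 T\<^sub>i\<^sup>4\<close>, which is a multiple
  of a product \<open>x\<^sub>k\<^sup>* x\<^sub>i\<close>, through products in the opposite order; modulo these and \<open>(ST)\<^sub>4\<^sup>4 = 1\<close> the
  entries of \<open>v\<^sup>* v - 1\<close> vanish (\<open>v_free_isometry\<close>). That \<open>p = v v\<^sup>*\<close> is a self-adjoint idempotent
  is then formal.

  For \<open>q = 1\<close> the matrix \<open>R\<close> is the identity and everything commutes. The entries of \<open>p\<close> are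
  affine combinations of five self-adjoint elements, two pairs of real and imaginary parts of
  off-diagonal entries and \<open>2 p\<^sub>1\<^sub>1 - 1\<close>, whose squares add up to \<open>1\<close> because
  \<open>\<Sum> x\<^sub>i\<^sup>* x\<^sub>i = 1\<close> (\<open>sphere_coord_unit\<close>). This gives a surjective *-homomorphism from the polynomial
  functions on the four-sphere. It is injective because the coordinates satisfy no further relation:
  over each point of the sphere with last coordinate different from \<open>-1\<close> lies an explicit symplectic unitary
  matrix, a point of the Hopf fibration, and evaluation there is a character of the coordinate algebra
  (\<open>hopf_character_eval\<close>). A polynomial killed by the homomorphism thus vanishes at all
  these points of the sphere, and such a polynomial lies in the ideal of the sphere:
  reduce it to \<open>a + b y\<^sub>4\<close> with \<open>a\<close>, \<open>b\<close> not involving \<open>y\<^sub>4\<close>, separate \<open>a\<close> from \<open>b\<close> by the two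
  signs of \<open>y\<^sub>4\<close>, and use that a polynomial vanishing on a box is zero (\<open>vanishing_on_sphere\<close>).
\<close>

section \<open>Algebras with involution\<close>

lemma complex_ring_simps [simp]:
  "carrier complex_ring = UNIV" "\<one>\<^bsub>complex_ring\<^esub> = 1" "\<zero>\<^bsub>complex_ring\<^esub> = 0"
  "c \<otimes>\<^bsub>complex_ring\<^esub> d = c * d" "c \<oplus>\<^bsub>complex_ring\<^esub> d = c + d"
  by (simp_all add: complex_ring_def)

lemma complex_ring_cring: "cring complex_ring"
proof -
  have "\<exists>d. c + d = 0" for c :: complex
    by (rule exI[of _ "- c"]) simp
  then have "abelian_group complex_ring"
    by (intro abelian_groupI) (auto simp: add.commute)
  moreover have "comm_monoid complex_ring"
    by unfold_locales auto
  ultimately show ?thesis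
    by (intro cringI) (auto simp: algebra_simps)
qed

lemma star_algebraI:
  fixes A :: "('a, 'm) star_alg_scheme" (structure)
  assumes "ring A"
    and "\<And>c x. x \<in> carrier A \<Longrightarrow> c \<odot> x \<in> carrier A"
    and "\<And>c d x. x \<in> carrier A \<Longrightarrow> (c + d) \<odot> x = c \<odot> x \<oplus> d \<odot> x"
    and "\<And>c x y. \<lbrakk>x \<in> carrier A; y \<in> carrier A\<rbrakk> \<Longrightarrow> c \<odot> (x \<oplus> y) = c \<odot> x \<oplus> c \<odot> y"
    and "\<And>c d x. x \<in> carrier A \<Longrightarrow> (c * d) \<odot> x = c \<odot> (d \<odot> x)"
    and "\<And>x. x \<in> carrier A \<Longrightarrow> 1 \<odot> x = x"
    and "\<And>c x y. \<lbrakk>x \<in> carrier A; y \<in> carrier A\<rbrakk> \<Longrightarrow> (c \<odot> x) \<otimes> y = c \<odot> (x \<otimes> y)"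
    and "\<And>c x y. \<lbrakk>x \<in> carrier A; y \<in> carrier A\<rbrakk> \<Longrightarrow> x \<otimes> (c \<odot> y) = c \<odot> (x \<otimes> y)"
    and "\<And>x. x \<in> carrier A \<Longrightarrow> star A x \<in> carrier A"
    and "\<And>x. x \<in> carrier A \<Longrightarrow> star A (star A x) = x"
    and "\<And>x y. \<lbrakk>x \<in> carrier A; y \<in> carrier A\<rbrakk> \<Longrightarrow> star A (x \<oplus> y) = star A x \<oplus> star A y"
    and "\<And>c x. x \<in> carrier A \<Longrightarrow> star A (c \<odot> x) = cnj c \<odot> star A x"
    and "\<And>x y. \<lbrakk>x \<in> carrier A; y \<in> carrier A\<rbrakk> \<Longrightarrow> star A (x \<otimes> y) = star A y \<otimes> star A x"
  shows "star_algebra A"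
proof -
  interpret ring A by fact
  have "module complex_ring A"
    using assms by (intro moduleI complex_ring_cring abelian_group_axioms) simp_all
  then show ?thesis
    using assms by (intro star_algebra.intro star_algebra_axioms.intro) simp_all
qed

context star_algebra
begin

lemmas ops_closed = smult_closed[unfolded complex_ring_simps, OF UNIV_I] star_closed m_closed
  a_closed a_inv_closed one_closed zero_closed

lemma smult_add_left: "x \<in> carrier A \<Longrightarrow> (c + d) \<odot> x = c \<odot> x \<oplus> d \<odot> x"
  using smult_l_distr[of c d x] by simp

lemma smult_add_right: "\<lbrakk>x \<in> carrier A; y \<in> carrier A\<rbrakk> \<Longrightarrow> c \<odot> (x \<oplus> y) = c \<odot> x \<oplus> c \<odot> y"
  using smult_r_distr[of c x y] by simp

lemma smult_smult: "x \<in> carrier A \<Longrightarrow> (c * d) \<odot> x = c \<odot> (d \<odot> x)"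
  using smult_assoc1[of c d x] by simp

lemma smult_1: "x \<in> carrier A \<Longrightarrow> 1 \<odot> x = x"
  using smult_one[of x] by simp

lemma smult_0: "x \<in> carrier A \<Longrightarrow> 0 \<odot> x = \<zero>"
  using smult_l_null[of x] by simp

lemma star_zero: "star A \<zero> = \<zero>"
  using star_add[of \<zero> \<zero>] by (simp add: star_closed)

lemma star_one: "star A \<one> = \<one>"
proof -
  have "star A \<one> \<otimes> star A (star A \<one>) = star A (star A \<one>)"
    using star_mult[of "star A \<one>" \<one>] by (simp add: ops_closed star_star)
  then show ?thesis
    by (simp add: star_star star_closed)
qed

lemma a_inv_smult: "x \<in> carrier A \<Longrightarrow> \<ominus> x = (- 1) \<odot> x"
  by (metis smult_0 smult_1 smult_add_left ops_closed(1) add.inv_equality add.left_inverse[of 1])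

lemma star_finsum:
  assumes "finite K" "\<And>k. k \<in> K \<Longrightarrow> f k \<in> carrier A"
  shows "star A (\<Oplus>k\<in>K. f k) = (\<Oplus>k\<in>K. star A (f k))"
  using assms
proof (induction K rule: finite_induct)
  case empty
  then show ?case by (simp add: star_zero)
next
  case (insert k K)
  then have "f \<in> K \<rightarrow> carrier A" "(\<lambda>k. star A (f k)) \<in> K \<rightarrow> carrier A"
    by (auto simp: star_closed)
  then show ?case
    using insert by (simp add: star_add finsum_closed star_closed)
qed

lemma finsum_swap:
  assumes "finite K" "finite L" "\<And>k l. \<lbrakk>k \<in> K; l \<in> L\<rbrakk> \<Longrightarrow> f k l \<in> carrier A"
  shows "(\<Oplus>k\<in>K. \<Oplus>l\<in>L. f k l) = (\<Oplus>l\<in>L. \<Oplus>k\<in>K. f k l)"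
  using assms(1,3)
proof (induction K rule: finite_induct)
  case empty
  then show ?case by simp
next
  case (insert k K)
  then have "(\<Oplus>k\<in>insert k K. \<Oplus>l\<in>L. f k l) = (\<Oplus>l\<in>L. f k l) \<oplus> (\<Oplus>l\<in>L. \<Oplus>k\<in>K. f k l)"
    by (subst finsum_insert) (auto intro!: finsum_closed)
  also have "\<dots> = (\<Oplus>l\<in>L. f k l \<oplus> (\<Oplus>k\<in>K. f k l))"
    using insert by (subst finsum_addf) (auto intro!: finsum_closed)
  also have "\<dots> = (\<Oplus>l\<in>L. \<Oplus>k\<in>insert k K. f k l)"
    using insert by (intro finsum_cong') (auto intro!: finsum_closed simp: finsum_insert)
  finally show ?case .
qed

end

subsection \<open>Matrices\<close>

context star_algebra
begin

lemma mat_mult_closed: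
  assumes "\<And>i k. M i k \<in> carrier A" "\<And>k j. N k j \<in> carrier A"
  shows "mat_mult A M N i j \<in> carrier A"
  using assms by (auto simp: mat_mult_def intro!: finsum_closed)

lemma mat_mult_assoc:
  fixes M :: "'i \<Rightarrow> 'k::finite \<Rightarrow> 'a" and N :: "'k \<Rightarrow> 'l::finite \<Rightarrow> 'a"
  assumes M: "\<And>i k. M i k \<in> carrier A" and N: "\<And>k l. N k l \<in> carrier A"
    and P: "\<And>l j. P l j \<in> carrier A"
  shows "mat_mult A (mat_mult A M N) P = mat_mult A M (mat_mult A N P)"
proof (intro ext)
  fix i j
  have "mat_mult A (mat_mult A M N) P i j = (\<Oplus>l\<in>UNIV. \<Oplus>k\<in>UNIV. M i k \<otimes> N k l \<otimes> P l j)"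
    unfolding mat_mult_def using assms
    by (intro finsum_cong') (auto intro!: finsum_closed simp: finsum_ldistr)
  also have "\<dots> = (\<Oplus>k\<in>UNIV. \<Oplus>l\<in>UNIV. M i k \<otimes> N k l \<otimes> P l j)"
    using assms by (intro finsum_swap) auto
  also have "\<dots> = mat_mult A M (mat_mult A N P) i j"
    unfolding mat_mult_def using assms
    by (intro finsum_cong') (auto intro!: finsum_closed simp: finsum_rdistr m_assoc)
  finally show "mat_mult A (mat_mult A M N) P i j = mat_mult A M (mat_mult A N P) i j" .
qed

lemma mat_mult_one_left:
  assumes "\<And>k j. N k j \<in> carrier A"
  shows "mat_mult A (mat_one A) N = N"
proof (intro ext)
  fix i j
  have "mat_mult A (mat_one A) N i j = (\<Oplus>k\<in>UNIV. if i = k then N k j else \<zero>)"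
    unfolding mat_mult_def mat_one_def using assms by (intro finsum_cong') auto
  also have "\<dots> = N i j"
    using assms by (subst add.finprod_singleton) auto
  finally show "mat_mult A (mat_one A) N i j = N i j" .
qed

lemma mat_star_mult:
  assumes "\<And>i k. M i k \<in> carrier A" "\<And>k j. N k j \<in> carrier A"
  shows "mat_star A (mat_mult A M N) = mat_mult A (mat_star A N) (mat_star A M)"
proof (intro ext)
  fix i j
  show "mat_star A (mat_mult A M N) i j = mat_mult A (mat_star A N) (mat_star A M) i j"
    using assms by (simp add: mat_star_def mat_mult_def star_finsum star_mult m_closed)
qed

lemma mat_star_star:
  assumes "\<And>i k. M i k \<in> carrier A"
  shows "mat_star A (mat_star A M) = M"
  using assms by (simp add: mat_star_def star_star)

text \<open>The associativity \<open>v v\<^sup>* v v\<^sup>* = v (v\<^sup>* v) v\<^sup>*\<close> turns an isometry into a projection.\<close>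

lemma isometry_projection:
  assumes v: "\<And>i k. v i k \<in> carrier A"
    and iso: "mat_mult A (mat_star A v) v = mat_one A"
  defines "p \<equiv> mat_mult A v (mat_star A v)"
  shows "mat_star A p = p" "mat_mult A p p = p"
proof -
  have v': "mat_star A v k i \<in> carrier A" for i k
    using v by (simp add: mat_star_def star_closed)
  show "mat_star A p = p"
    unfolding p_def using v v' by (subst mat_star_mult) (auto simp: mat_star_star)
  have "mat_mult A p p = mat_mult A v (mat_mult A (mat_mult A (mat_star A v) v) (mat_star A v))"
    unfolding p_def using v v' by (simp add: mat_mult_assoc mat_mult_closed)
  also have "\<dots> = p"
    unfolding iso p_def using v' by (simp add: mat_mult_one_left)
  finally show "mat_mult A p p = p" .
qed

end

subsection \<open>Subalgebras\<close>

lemma unital_subalgebraD: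
  assumes "unital_subalgebra B A"
  shows "B \<subseteq> carrier A" "subring B A" "\<And>c x. x \<in> B \<Longrightarrow> c \<odot>\<^bsub>A\<^esub> x \<in> B"
    "\<one>\<^bsub>A\<^esub> \<in> B" "\<zero>\<^bsub>A\<^esub> \<in> B" "\<And>x y. \<lbrakk>x \<in> B; y \<in> B\<rbrakk> \<Longrightarrow> x \<oplus>\<^bsub>A\<^esub> y \<in> B"
    "\<And>x y. \<lbrakk>x \<in> B; y \<in> B\<rbrakk> \<Longrightarrow> x \<otimes>\<^bsub>A\<^esub> y \<in> B"
  using assms subringE[of B A] by (auto simp: unital_subalgebra_def)

context star_algebra
begin

lemma unital_subalgebraI:
  assumes "B \<subseteq> carrier A" "\<one> \<in> B" "\<And>x y. \<lbrakk>x \<in> B; y \<in> B\<rbrakk> \<Longrightarrow> x \<oplus> y \<in> B"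
    "\<And>x y. \<lbrakk>x \<in> B; y \<in> B\<rbrakk> \<Longrightarrow> x \<otimes> y \<in> B" "\<And>c x. x \<in> B \<Longrightarrow> c \<odot> x \<in> B"
  shows "unital_subalgebra B A"
proof -
  have "subring B A"
    using assms by (intro subringI) (auto simp: a_inv_smult subset_iff)
  then show ?thesis
    using assms by (auto simp: unital_subalgebra_def)
qed

lemma unital_subalgebra_carrier: "unital_subalgebra (carrier A) A"
  by (rule unital_subalgebraI) (auto simp: ops_closed)

lemma star_algebra_restrict:
  assumes B: "unital_subalgebra B A" and "\<And>x. x \<in> B \<Longrightarrow> star A x \<in> B"
  shows "star_algebra (A\<lparr>carrier := B\<rparr>)"
proof -
  note D = unital_subalgebraD[OF B]
  have "x \<in> carrier A" if "x \<in> B" for x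
    using that D by auto
  moreover have "ring (A\<lparr>carrier := B\<rparr>)"
    by (rule subring_is_ring[OF D(2)])
  ultimately show ?thesis
    using assms D
    by (intro star_algebraI)
      (simp_all add: smult_add_left smult_add_right smult_smult smult_1 smult_mult_left
        smult_mult_right star_star star_add star_smult star_mult)
qed

lemma generated_unital_subalgebra:
  assumes "S \<subseteq> carrier A"
  shows "unital_subalgebra (carrier (generated_subalgebra A S)) A"
proof -
  have "carrier A \<in> {B. unital_subalgebra B A \<and> S \<subseteq> B}"
    using assms unital_subalgebra_carrier by simp
  then show ?thesis
    unfolding generated_subalgebra_def
    by (intro unital_subalgebraI)
      (simp_all add: unital_subalgebraD(3,4,6,7), blast)
qed

lemma generators_in_generated: "S \<subseteq> carrier (generated_subalgebra A S)"
  by (auto simp: generated_subalgebra_def)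

lemma generated_minimal:
  assumes "unital_subalgebra B A" "S \<subseteq> B"
  shows "carrier (generated_subalgebra A S) \<subseteq> B"
  using assms by (auto simp: generated_subalgebra_def)

text \<open>The elements whose adjoint lies in the generated subalgebra form a subalgebra containing the
  generators, by minimality all of it.\<close>

lemma generated_star_algebra:
  assumes S: "S \<subseteq> carrier A" and star: "\<And>x. x \<in> S \<Longrightarrow> star A x \<in> S"
  shows "star_algebra (generated_subalgebra A S)"
proof -
  let ?B = "carrier (generated_subalgebra A S)"
  note B = generated_unital_subalgebra[OF S]
  note D = unital_subalgebraD[OF B]
  have sub: "x \<in> carrier A" if "x \<in> ?B" for x
    using D(1) that by auto
  have "unital_subalgebra {x \<in> ?B. star A x \<in> ?B} A"
    using D by (intro unital_subalgebraI) (auto simp: sub star_one star_add star_mult star_smult)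
  moreover have "S \<subseteq> {x \<in> ?B. star A x \<in> ?B}"
    using generators_in_generated star by blast
  ultimately have "?B \<subseteq> {x \<in> ?B. star A x \<in> ?B}"
    by (rule generated_minimal)
  then have "star_algebra (A\<lparr>carrier := ?B\<rparr>)"
    by (intro star_algebra_restrict B) auto
  then show ?thesis
    by (simp add: generated_subalgebra_def)
qed

end

lemma generated_subalgebra_simps [simp]:
  "mult (generated_subalgebra A S) = mult A" "one (generated_subalgebra A S) = one A"
  "zero (generated_subalgebra A S) = zero A" "add (generated_subalgebra A S) = add A"
  "c \<odot>\<^bsub>generated_subalgebra A S\<^esub> x = c \<odot>\<^bsub>A\<^esub> x" "star (generated_subalgebra A S) = star A"
  by (simp_all add: generated_subalgebra_def)

subsection \<open>Quotients\<close>

text \<open>All axioms are equations, so they pass to any image under a map that respects the operations.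
  This turns the quotient map into a proof that the quotient is a *-algebra.\<close>

lemma star_algebra_hom_image:
  fixes A :: "('a, 'm) star_alg_scheme" (structure) and B :: "('b, 'n) star_alg_scheme"
  assumes A: "star_algebra A" and B: "carrier B = h ` carrier A"
    and h: "h \<one> = \<one>\<^bsub>B\<^esub>" "h \<zero> = \<zero>\<^bsub>B\<^esub>"
      "\<And>x y. \<lbrakk>x \<in> carrier A; y \<in> carrier A\<rbrakk> \<Longrightarrow> h (x \<oplus> y) = h x \<oplus>\<^bsub>B\<^esub> h y"
      "\<And>x y. \<lbrakk>x \<in> carrier A; y \<in> carrier A\<rbrakk> \<Longrightarrow> h (x \<otimes> y) = h x \<otimes>\<^bsub>B\<^esub> h y"
      "\<And>c x. x \<in> carrier A \<Longrightarrow> h (c \<odot> x) = c \<odot>\<^bsub>B\<^esub> h x"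
      "\<And>x. x \<in> carrier A \<Longrightarrow> h (star A x) = star B (h x)"
  shows "star_algebra B"
proof -
  interpret A: star_algebra A by fact
  note h' = h[symmetric]
  have "abelian_group B"
  proof (rule abelian_groupI)
    fix x assume "x \<in> carrier B"
    then obtain a where "a \<in> carrier A" "x = h a" by (auto simp: B)
    then have "h (\<ominus> a) \<in> carrier B" "h (\<ominus> a) \<oplus>\<^bsub>B\<^esub> x = \<zero>\<^bsub>B\<^esub>"
      by (auto simp: B h' A.l_neg)
    then show "\<exists>y\<in>carrier B. y \<oplus>\<^bsub>B\<^esub> x = \<zero>\<^bsub>B\<^esub>" by blast
  qed (auto simp: B h' A.a_ac)
  moreover have "monoid B"
    by (rule monoidI) (auto simp: B h' A.m_assoc)
  ultimately have "ring B"
    by (rule ringI) (auto simp: B h' A.l_distr A.r_distr)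
  then show ?thesis
    by (rule star_algebraI)
      (auto simp: B h' A.ops_closed A.smult_add_left A.smult_add_right A.smult_smult A.smult_1
        A.smult_mult_left A.smult_mult_right A.star_star A.star_add A.star_smult A.star_mult)
qed

text \<open>Stability under the involution is what makes the involution descend to cosets.\<close>

locale star_ideal = star_algebra A + ideal I A
  for A :: "('a, 'm) star_alg_scheme" (structure) and I +
  assumes star_in_ideal: "x \<in> I \<Longrightarrow> star A x \<in> I"
begin

lemma smult_in_ideal: "x \<in> I \<Longrightarrow> c \<odot> x \<in> I"
  using I_l_closed[of x "c \<odot> \<one>"] by (simp add: smult_mult_left ops_closed a_Hcarr)

lemma coset_eq_iff: "\<lbrakk>x \<in> carrier A; y \<in> carrier A\<rbrakk> \<Longrightarrow> I +> x = I +> y \<longleftrightarrow> x \<ominus> y \<in> I"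
  using quotient_eq_iff_same_a_r_cos[OF ideal_axioms] by simp

lemma smult_coset:
  assumes x: "x \<in> carrier A"
  shows "c \<odot>\<^bsub>star_quot A I\<^esub> (I +> x) = I +> (c \<odot> x)"
proof -
  have "I <+>\<^bsub>A\<^esub> (\<lambda>y. c \<odot> y) ` (I +> x) = I +> (c \<odot> x)"
  proof (intro subset_antisym subsetI)
    fix y assume "y \<in> I <+>\<^bsub>A\<^esub> (\<lambda>y. c \<odot> y) ` (I +> x)"
    then obtain a b where ab: "a \<in> I" "b \<in> I" "y = a \<oplus> c \<odot> (b \<oplus> x)"
      by (auto simp: set_add_defs a_r_coset_def r_coset_def)
    then have "y = (a \<oplus> c \<odot> b) \<oplus> c \<odot> x"
      using x by (simp add: smult_add_right a_Hcarr ops_closed a_assoc)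
    moreover have "a \<oplus> c \<odot> b \<in> I"
      using ab by (simp add: smult_in_ideal)
    ultimately show "y \<in> I +> (c \<odot> x)"
      by (auto simp: a_r_coset_def r_coset_def)
  next
    fix y assume "y \<in> I +> (c \<odot> x)"
    then obtain a where "a \<in> I" "y = a \<oplus> c \<odot> x"
      by (auto simp: a_r_coset_def r_coset_def)
    then show "y \<in> I <+>\<^bsub>A\<^esub> (\<lambda>y. c \<odot> y) ` (I +> x)"
      using x a_rcos_self[OF x] by (auto simp: set_add_defs)
  qed
  then show ?thesis
    by (simp add: star_quot_def)
qed

lemma star_coset:
  assumes x: "x \<in> carrier A"
  shows "star (star_quot A I) (I +> x) = I +> star A x"
proof -
  have "star A ` (I +> x) = I +> star A x"
  proof (intro subset_antisym subsetI)
    fix y assume "y \<in> star A ` (I +> x)"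
    then obtain a where "a \<in> I" "y = star A (a \<oplus> x)"
      by (auto simp: a_r_coset_def r_coset_def)
    then show "y \<in> I +> star A x"
      using x star_in_ideal[of a] by (auto simp: star_add a_Hcarr a_r_coset_def r_coset_def)
  next
    fix y assume "y \<in> I +> star A x"
    then obtain a where a: "a \<in> I" "y = a \<oplus> star A x"
      by (auto simp: a_r_coset_def r_coset_def)
    then have "y = star A (star A a \<oplus> x)"
      using x by (simp add: star_add star_star star_closed a_Hcarr)
    then show "y \<in> star A ` (I +> x)"
      using a star_in_ideal by (auto simp: a_r_coset_def r_coset_def)
  qed
  then show ?thesis
    by (simp add: star_quot_def)
qed

lemma carrier_quot: "carrier (star_quot A I) = (\<lambda>x. I +> x) ` carrier A"
  by (auto simp: star_quot_def FactRing_simps a_r_coset_def[symmetric])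

lemma coset_hom:
  "\<one>\<^bsub>star_quot A I\<^esub> = I +> \<one>" "\<zero>\<^bsub>star_quot A I\<^esub> = I +> \<zero>"
  "\<lbrakk>x \<in> carrier A; y \<in> carrier A\<rbrakk> \<Longrightarrow> (I +> x) \<oplus>\<^bsub>star_quot A I\<^esub> (I +> y) = I +> (x \<oplus> y)"
  "\<lbrakk>x \<in> carrier A; y \<in> carrier A\<rbrakk> \<Longrightarrow> (I +> x) \<otimes>\<^bsub>star_quot A I\<^esub> (I +> y) = I +> (x \<otimes> y)"
  by (simp_all add: star_quot_def FactRing_def a_rcos_sum rcoset_mult_add a_coset_add_zero a_subset)

lemma star_algebra_quot: "star_algebra (star_quot A I)"
  by (rule star_algebra_hom_image[OF star_algebra_axioms carrier_quot])
    (simp_all add: coset_hom smult_coset star_coset)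

end

text \<open>The first isomorphism theorem. The isomorphism goes from the image to the quotient: it sends
  \<open>h x\<close> to the coset of \<open>x\<close>, which is well defined and injective by the hypothesis on the kernel.\<close>

lemma star_isomorphic_quot:
  fixes A :: "('a, 'm) star_alg_scheme" (structure) and B :: "('b, 'n) star_alg_scheme"
  assumes I: "star_ideal A I" and B: "carrier B = h ` carrier A"
    and ker: "\<And>x y. \<lbrakk>x \<in> carrier A; y \<in> carrier A\<rbrakk> \<Longrightarrow> h x = h y \<longleftrightarrow> x \<ominus> y \<in> I"
    and h: "h \<one> = \<one>\<^bsub>B\<^esub>"
      "\<And>x y. \<lbrakk>x \<in> carrier A; y \<in> carrier A\<rbrakk> \<Longrightarrow> h (x \<oplus> y) = h x \<oplus>\<^bsub>B\<^esub> h y"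
      "\<And>x y. \<lbrakk>x \<in> carrier A; y \<in> carrier A\<rbrakk> \<Longrightarrow> h (x \<otimes> y) = h x \<otimes>\<^bsub>B\<^esub> h y"
      "\<And>c x. x \<in> carrier A \<Longrightarrow> h (c \<odot> x) = c \<odot>\<^bsub>B\<^esub> h x"
      "\<And>x. x \<in> carrier A \<Longrightarrow> h (star A x) = star B (h x)"
  shows "star_isomorphic B (star_quot A I)"
proof -
  interpret star_ideal A I by fact
  define g where "g b = I +> (SOME x. x \<in> carrier A \<and> h x = b)" for b
  have g: "g (h x) = I +> x" if x: "x \<in> carrier A" for x
  proof -
    have "(SOME y. y \<in> carrier A \<and> h y = h x) \<in> carrier A \<and>
        h (SOME y. y \<in> carrier A \<and> h y = h x) = h x"
      by (rule someI[where x = x]) (simp add: x)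
    then show ?thesis
      using x ker coset_eq_iff by (auto simp: g_def)
  qed
  have "inj_on g (carrier B)"
    using ker coset_eq_iff by (auto simp: inj_on_def B g)
  moreover have "g ` carrier B = carrier (star_quot A I)"
    by (simp add: B image_image carrier_quot g)
  moreover have "g \<in> ring_hom B (star_quot A I)"
    by (rule ring_hom_memI)
      (auto simp: B carrier_quot g coset_hom simp flip: h)
  ultimately have "g \<in> ring_iso B (star_quot A I)"
    by (simp add: ring_iso_def bij_betw_def)
  moreover have "\<forall>c. \<forall>x\<in>carrier B. g (c \<odot>\<^bsub>B\<^esub> x) = c \<odot>\<^bsub>star_quot A I\<^esub> g x"
    "\<forall>x\<in>carrier B. g (star B x) = star (star_quot A I) (g x)"
    by (auto simp: B g smult_coset star_coset ops_closed simp flip: h)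
  ultimately show ?thesis
    unfolding star_isomorphic_def by blast
qed

section \<open>Monoid algebras and free algebras\<close>

lemma poly_mapping_single_induct [case_names single add]:
  fixes f :: "'m \<Rightarrow>\<^sub>0 'c::comm_monoid_add"
  assumes "\<And>m c. P (Poly_Mapping.single m c)" "\<And>f g. \<lbrakk>P f; P g\<rbrakk> \<Longrightarrow> P (f + g)"
  shows "P f"
proof (induction f rule: update_induct)
  case const
  show ?case using assms(1)[of undefined 0] by simp
next
  case (update f m c)
  have "Poly_Mapping.update m c f = f + Poly_Mapping.single m c"
    using update(1)
    by (intro poly_mapping_eqI) (auto simp: lookup_update lookup_add lookup_single in_keys_iff)
  then show ?case
    using assms update by simp
qed

text \<open>The additive extension of a map on monomials. Allowing \<open>h\<close> to depend on the coefficient,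
  additively, covers both linear and antilinear extensions.\<close>

definition lin_ext :: "('m \<Rightarrow> 'c::comm_monoid_add \<Rightarrow> 'r::ab_group_add) \<Rightarrow> ('m \<Rightarrow>\<^sub>0 'c) \<Rightarrow> 'r" where
  "lin_ext h f = (\<Sum>m\<in>Poly_Mapping.keys f. h m (Poly_Mapping.lookup f m))"

locale additive_family =
  fixes h :: "'m \<Rightarrow> 'c::comm_monoid_add \<Rightarrow> 'r::ab_group_add"
  assumes family_add: "h m (c + d) = h m c + h m d"
begin

lemma family_zero: "h m 0 = 0"
  using family_add[of m 0 0] by simp

lemma lin_ext_single [simp]: "lin_ext h (Poly_Mapping.single m c) = h m c"
  by (auto simp: lin_ext_def family_zero)

lemma lin_ext_add: "lin_ext h (f + g) = lin_ext h f + lin_ext h g"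
  unfolding lin_ext_def
  by (rule setsum_keys_plus_distrib) (simp_all add: family_zero family_add)

end

text \<open>The product \<open>op\<close> on the target is left open so that \<open>op x y = y * x\<close> yields anti-homomorphisms:
  the involutions, the evaluations of polynomials and the characters are all instances.\<close>

lemma lin_ext_mult:
  fixes h :: "'m::monoid_add \<Rightarrow> 'c::semiring_0 \<Rightarrow> 'r::ab_group_add"
  assumes "additive_family h"
    and mult: "\<And>m n c d. h (m + n) (c * d) = op (h m c) (h n d)"
    and op: "\<And>x y z. op (x + y) z = op x z + op y z" "\<And>x y z. op x (y + z) = op x y + op x z"
  shows "lin_ext h (f * g) = op (lin_ext h f) (lin_ext h g)"
proof -
  interpret additive_family h by fact
  have "lin_ext h (Poly_Mapping.single m c * g) = op (h m c) (lin_ext h g)" for m c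
    by (induction g rule: poly_mapping_single_induct)
      (simp_all add: mult_single mult distrib_left lin_ext_add op)
  then show ?thesis
    by (induction f rule: poly_mapping_single_induct) (simp_all add: distrib_right lin_ext_add op)
qed

lemma const_hom:
  "const 0 = (0 :: 'm::monoid_add \<Rightarrow>\<^sub>0 complex)" "const 1 = (1 :: 'm \<Rightarrow>\<^sub>0 complex)"
  "const (c + d) = (const c + const d :: 'm \<Rightarrow>\<^sub>0 complex)"
  "const (c * d) = (const c * const d :: 'm \<Rightarrow>\<^sub>0 complex)"
  "const (- c) = (- const c :: 'm \<Rightarrow>\<^sub>0 complex)"
  "const (c - d) = (const c - const d :: 'm \<Rightarrow>\<^sub>0 complex)"
  by (simp_all add: const_def single_add mult_single single_uminus single_diff)

lemma const_central: "const c * f = f * (const c :: 'm::monoid_add \<Rightarrow>\<^sub>0 complex)"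
  by (induction f rule: poly_mapping_single_induct)
    (simp_all add: const_def mult_single distrib_left distrib_right mult.commute)

lemma const_left_commute:
  "f * (const c * g) = const c * (f * g :: 'm::monoid_add \<Rightarrow>\<^sub>0 complex)"
  by (metis const_central mult.assoc)

lemma const_mult_single:
  "const c * Poly_Mapping.single m d = Poly_Mapping.single (m::'m::monoid_add) (c * d)"
  by (simp add: const_def mult_single)

lemma monoid_star_alg_simps [simp]:
  "carrier (monoid_star_alg s) = UNIV" "f \<otimes>\<^bsub>monoid_star_alg s\<^esub> g = f * g"
  "\<one>\<^bsub>monoid_star_alg s\<^esub> = 1" "\<zero>\<^bsub>monoid_star_alg s\<^esub> = 0" "f \<oplus>\<^bsub>monoid_star_alg s\<^esub> g = f + g"
  "c \<odot>\<^bsub>monoid_star_alg s\<^esub> f = const c * f" "star (monoid_star_alg s) = s"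
  by (simp_all add: monoid_star_alg_def)

lemma ring_monoid_star_alg: "ring (monoid_star_alg s)"
proof -
  have "\<exists>g. g + f = 0" for f :: "'a \<Rightarrow>\<^sub>0 complex"
    by (rule exI[of _ "- f"]) simp
  then have "abelian_group (monoid_star_alg s)"
    by (intro abelian_groupI) (auto simp: algebra_simps)
  moreover have "monoid (monoid_star_alg s)"
    by (rule monoidI) (auto simp: mult.assoc)
  ultimately show ?thesis
    by (rule ringI) (auto simp: algebra_simps)
qed

lemma monoid_star_alg_minus [simp]:
  "\<ominus>\<^bsub>monoid_star_alg s\<^esub> f = - f" "f \<ominus>\<^bsub>monoid_star_alg s\<^esub> g = f - g"
proof -
  interpret ring "monoid_star_alg s" by (rule ring_monoid_star_alg)
  show *: "\<ominus>\<^bsub>monoid_star_alg s\<^esub> f = - f" for f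
    using minus_equality[of "- f" f] by simp
  show "f \<ominus>\<^bsub>monoid_star_alg s\<^esub> g = f - g"
    by (simp add: a_minus_def *)
qed

lemma star_algebra_monoid_star_alg:
  fixes s :: "('m::monoid_add \<Rightarrow>\<^sub>0 complex) \<Rightarrow> ('m \<Rightarrow>\<^sub>0 complex)"
  assumes "\<And>f. s (s f) = f" "\<And>f g. s (f + g) = s f + s g" "\<And>f g. s (f * g) = s g * s f"
    "\<And>c. s (const c) = const (cnj c)"
  shows "star_algebra (monoid_star_alg s)"
proof (rule star_algebraI[OF ring_monoid_star_alg])
  fix c f g
  show "f \<otimes>\<^bsub>monoid_star_alg s\<^esub> (c \<odot>\<^bsub>monoid_star_alg s\<^esub> g) =
      c \<odot>\<^bsub>monoid_star_alg s\<^esub> (f \<otimes>\<^bsub>monoid_star_alg s\<^esub> g)"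
    by (simp add: const_left_commute[of f])
  show "star (monoid_star_alg s) (c \<odot>\<^bsub>monoid_star_alg s\<^esub> f) =
      cnj c \<odot>\<^bsub>monoid_star_alg s\<^esub> star (monoid_star_alg s) f"
    by (simp add: assms const_central[of _ "s f"])
qed (simp_all add: assms const_hom distrib_left distrib_right mult.assoc)

subsection \<open>Two-sided ideals\<close>

text \<open>Two-sided ideals of a ring given by a type class. Congruences modulo such an ideal allow calculations with
  the relations inside the free algebra, where matrix multiplication is available.\<close>

locale two_sided_ideal =
  fixes I :: "'a::ring_1 set"
  assumes zero: "0 \<in> I" and add: "\<lbrakk>x \<in> I; y \<in> I\<rbrakk> \<Longrightarrow> x + y \<in> I"
    and left: "x \<in> I \<Longrightarrow> z * x \<in> I" and right: "x \<in> I \<Longrightarrow> x * z \<in> I"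
begin

lemma uminus: "x \<in> I \<Longrightarrow> - x \<in> I"
  using left[of x "- 1"] by simp

lemma sum: "(\<And>k. k \<in> K \<Longrightarrow> f k \<in> I) \<Longrightarrow> sum f K \<in> I"
  by (induction K rule: infinite_finite_induct) (auto simp: zero add)

definition mat_cong :: "'a^'n^'m \<Rightarrow> 'a^'n^'m \<Rightarrow> bool" (infix \<open>\<approx>\<close> 50) where
  "M \<approx> N \<longleftrightarrow> (\<forall>i j. (M - N) $ i $ j \<in> I)"

lemma mat_cong_refl: "M \<approx> M"
  by (simp add: mat_cong_def zero)

lemma mat_cong_sym: "M \<approx> N \<Longrightarrow> N \<approx> M"
  using uminus by (force simp: mat_cong_def)

lemma mat_cong_trans [trans]: "\<lbrakk>M \<approx> N; N \<approx> P\<rbrakk> \<Longrightarrow> M \<approx> P"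
proof -
  assume "M \<approx> N" "N \<approx> P"
  moreover have "(M - P) $ i $ j = (M - N) $ i $ j + (N - P) $ i $ j" for i j
    by simp
  ultimately show "M \<approx> P"
    by (simp only: mat_cong_def add simp_thms)
qed

lemma mat_cong_mult:
  fixes M M' :: "'a^'n::finite^'m" and N N' :: "'a^'p^'n"
  assumes "M \<approx> M'" "N \<approx> N'"
  shows "M ** N \<approx> M' ** N'"
proof -
  have "(M ** N - M' ** N') $ i $ j =
      (\<Sum>k\<in>UNIV. (M - M') $ i $ k * N $ k $ j + M' $ i $ k * (N - N') $ k $ j)" for i j
    by (simp add: matrix_matrix_mult_def sum_subtractf algebra_simps flip: sum.distrib)
  moreover have "(M - M') $ i $ k * N $ k $ j \<in> I" "M' $ i $ k * (N - N') $ k $ j \<in> I" for i j k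
    using assms left right by (auto simp: mat_cong_def)
  ultimately show ?thesis
    unfolding mat_cong_def by (auto simp del: vector_minus_component intro!: sum add)
qed

end

lemma ideal_monoid_star_alg_iff:
  fixes s :: "('m::monoid_add \<Rightarrow>\<^sub>0 complex) \<Rightarrow> ('m \<Rightarrow>\<^sub>0 complex)"
  shows "ideal I (monoid_star_alg s) \<longleftrightarrow> two_sided_ideal I"
proof
  assume "ideal I (monoid_star_alg s)"
  then interpret ideal I "monoid_star_alg s" .
  show "two_sided_ideal I"
    using additive_subgroup.zero_closed[OF additive_subgroup_axioms]
      additive_subgroup.a_closed[OF additive_subgroup_axioms] I_l_closed I_r_closed
    by unfold_locales auto
next
  assume "two_sided_ideal I"
  then interpret two_sided_ideal I .
  interpret R: ring "monoid_star_alg s" by (rule ring_monoid_star_alg)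
  have "subgroup I (add_monoid (monoid_star_alg s))"
    by (rule R.add.subgroupI) (use zero uminus add in \<open>auto simp flip: a_inv_def\<close>)
  then show "ideal I (monoid_star_alg s)"
    by (intro idealI ring_monoid_star_alg) (auto intro: left right)
qed

lemma genideal_two_sided: "two_sided_ideal (Idl\<^bsub>monoid_star_alg s\<^esub> S)"
  using ring.genideal_ideal[OF ring_monoid_star_alg, of S s]
  by (simp add: ideal_monoid_star_alg_iff)

lemma genideal_subset: "S \<subseteq> Idl\<^bsub>monoid_star_alg s\<^esub> S"
  using ring.genideal_self[OF ring_monoid_star_alg, of S s] by simp

lemma genideal_least:
  assumes "two_sided_ideal J" "S \<subseteq> J"
  shows "Idl\<^bsub>monoid_star_alg s\<^esub> S \<subseteq> J"
  using ring.genideal_minimal[OF ring_monoid_star_alg _ assms(2), of s] assms(1)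
  by (simp add: ideal_monoid_star_alg_iff)

text \<open>It suffices to test stability on generators: the elements of the ideal whose adjoint is also in
  it form an ideal.\<close>

lemma star_ideal_genideal:
  fixes s :: "('m::monoid_add \<Rightarrow>\<^sub>0 complex) \<Rightarrow> ('m \<Rightarrow>\<^sub>0 complex)"
  assumes "star_algebra (monoid_star_alg s)"
    and S: "\<And>x. x \<in> S \<Longrightarrow> s x \<in> Idl\<^bsub>monoid_star_alg s\<^esub> S"
  shows "star_ideal (monoid_star_alg s) (Idl\<^bsub>monoid_star_alg s\<^esub> S)"
proof -
  let ?I = "Idl\<^bsub>monoid_star_alg s\<^esub> S"
  interpret star_algebra "monoid_star_alg s" by fact
  interpret I: two_sided_ideal ?I by (rule genideal_two_sided)
  have "two_sided_ideal {x \<in> ?I. s x \<in> ?I}"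
    using star_zero star_add star_mult
    by unfold_locales (auto intro: I.zero I.add I.left I.right)
  then have "?I \<subseteq> {x \<in> ?I. s x \<in> ?I}"
    using S genideal_subset by (intro genideal_least) blast+
  moreover have "ideal ?I (monoid_star_alg s)"
    by (simp add: ideal_monoid_star_alg_iff I.two_sided_ideal_axioms)
  ultimately show ?thesis
    by (intro star_ideal.intro star_ideal_axioms.intro star_algebra_axioms) auto
qed

subsection \<open>The involution of a free algebra\<close>

lemma gen_mult: "gen x * Poly_Mapping.single w c = Poly_Mapping.single (Word [x] + w) c"
  by (simp add: gen_def mult_single)

lemma prod_list_gen: "prod_list (map gen xs) = Poly_Mapping.single (Word xs) 1"
  by (induction xs) (simp_all add: gen_mult plus_free_monoid_def flip: zero_free_monoid_def)

interpretation free_star: additive_family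
  "\<lambda>w c. const (cnj c) * prod_list (map s (rev (letters w)))"
  for s :: "'x \<Rightarrow> 'x free_alg"
  by unfold_locales (simp add: const_hom distrib_right)

lemma free_star_lin_ext:
  "free_star s = lin_ext (\<lambda>w c. const (cnj c) * prod_list (map s (rev (letters w))))"
  by (simp add: fun_eq_iff free_star_def lin_ext_def)

lemma free_star_add: "free_star s (f + g) = free_star s f + free_star s g"
  by (simp add: free_star_lin_ext free_star.lin_ext_add)

lemma free_star_mult: "free_star s (f * g) = free_star s g * free_star s f"
  unfolding free_star_lin_ext
proof (rule lin_ext_mult[where op = "\<lambda>x y. y * x"])
  fix w u :: "'a free_monoid" and c d :: complex
  let ?p = "\<lambda>w. prod_list (map s (rev (letters w)))"
  have "const (cnj d) * ?p u * (const (cnj c) * ?p w) = const (cnj c) * (const (cnj d) * ?p u * ?p w)"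
    by (rule const_left_commute)
  then show "const (cnj (c * d)) * ?p (w + u) = const (cnj d) * ?p u * (const (cnj c) * ?p w)"
    by (simp add: plus_free_monoid_def const_hom mult.assoc)
qed (simp_all add: free_star.additive_family_axioms algebra_simps)

lemma free_star_const: "free_star s (const c) = const (cnj c)"
proof -
  have "free_star s (const c) = const (cnj c) * prod_list (map s (rev (letters 0)))"
    unfolding const_def[of c] free_star_lin_ext by (rule free_star.lin_ext_single)
  then show ?thesis
    by (simp add: zero_free_monoid_def)
qed

lemma free_star_const_mult: "free_star s (const c * f) = const (cnj c) * free_star s f"
  by (simp add: free_star_mult free_star_const const_central[of _ "free_star s f"])

lemma free_star_gen: "free_star s (gen x) = s x"
  by (simp add: free_star_lin_ext gen_def const_hom)

lemma free_star_one: "free_star s 1 = 1"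
  using free_star_const[of s 1] by (simp add: const_hom)

lemma free_star_diff: "free_star s (f - g) = free_star s f - free_star s g"
  using free_star_add[of s "f - g" g] by simp

lemma free_star_sum: "free_star s (sum f K) = (\<Sum>k\<in>K. free_star s (f k))"
proof (induction K rule: infinite_finite_induct)
  case empty
  show ?case using free_star_add[of s 0 0] by simp
next
  case infinite
  then show ?case using free_star_add[of s 0 0] by simp
qed (simp add: free_star_add)

lemma free_star_prod_list:
  "free_star s (prod_list fs) = prod_list (rev (map (free_star s) fs))"
  by (induction fs) (simp_all add: free_star_one free_star_mult)

text \<open>Both sides are additive and the involution reverses words twice, so the generators decide.\<close>

lemma free_star_involutive:
  assumes "\<And>x. free_star s (s x) = gen x"
  shows "free_star s (free_star s f) = f"
proof (induction f rule: poly_mapping_single_induct)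
  case (single w c)
  have "free_star s (free_star s (Poly_Mapping.single w c)) = prod_list (map gen (letters w)) * const c"
    using assms
    by (simp add: free_star_lin_ext[THEN fun_cong, of s "Poly_Mapping.single w c"] free_star_mult
        free_star_const free_star_prod_list rev_map comp_def)
  also have "\<dots> = const c * prod_list (map gen (letters w))"
    by (simp only: const_central)
  finally show ?case
    by (simp add: prod_list_gen const_mult_single)
qed (simp add: free_star_add)

lemma star_algebra_free:
  assumes "\<And>x. free_star s (s x) = gen x"
  shows "star_algebra (monoid_star_alg (free_star s))"
  by (rule star_algebra_monoid_star_alg)
    (simp_all add: free_star_involutive[OF assms] free_star_add free_star_mult free_star_const)

section \<open>The quantum symplectic group is a *-algebra\<close>

definition sp_star :: "real \<Rightarrow> sp_free \<Rightarrow> sp_free" where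
  "sp_star q = free_star (\<lambda>(i, j). ST_mat q $ j $ i)"

lemma sp_star_T: "sp_star q (T_mat $ i $ j) = ST_mat q $ j $ i"
  by (simp add: sp_star_def T_mat_def free_star_gen)

text \<open>The scalar in \<open>S(T)\<^sub>i\<^sup>j\<close>, which is a multiple of a single generator.\<close>

definition antipode_coeff :: "real \<Rightarrow> idx \<Rightarrow> idx \<Rightarrow> real" where
  "antipode_coeff q i j = - (q powi (rho (prime_idx i) + rho j)) * sgn_idx i * sgn_idx (prime_idx j)"

lemma ST_mat_eq:
  assumes "q \<noteq> 0"
  shows "ST_mat q $ i $ j =
    const (complex_of_real (antipode_coeff q i j)) * gen (prime_idx j, prime_idx i)"
  using ST_mat_entry[OF assms] by (simp add: antipode_coeff_def)

lemma prime_idx_involutive [simp]: "prime_idx (prime_idx i) = i"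
  by (cases i) simp_all

lemma rho_prime_idx: "rho (prime_idx i) = - rho i"
  by (cases i) simp_all

lemma antipode_coeff_inverse:
  assumes "q \<noteq> 0"
  shows "antipode_coeff q i j * antipode_coeff q (prime_idx i) (prime_idx j) = 1"
proof -
  have "antipode_coeff q i j * antipode_coeff q (prime_idx i) (prime_idx j) =
      (q powi (rho j - rho i) * q powi (rho i - rho j)) *
      (sgn_idx i * sgn_idx (prime_idx i) * (sgn_idx j * sgn_idx (prime_idx j)))"
    by (simp add: antipode_coeff_def rho_prime_idx mult_ac)
  moreover have "q powi (rho j - rho i) * q powi (rho i - rho j) = 1"
    using assms by (simp flip: power_int_add)
  moreover have "sgn_idx i * sgn_idx (prime_idx i) = -1" for i
    by (cases i) simp_all
  ultimately show ?thesis
    by simp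
qed

text \<open>The two scalars produced by applying the antipode twice are inverse to each other since
  \<open>\<rho>\<close> and \<open>\<epsilon>\<close> change sign under \<open>i \<mapsto> i'\<close>.\<close>

lemma sp_star_ST:
  assumes q: "q \<noteq> 0"
  shows "sp_star q (ST_mat q $ i $ j) = T_mat $ j $ i"
proof -
  have "sp_star q (ST_mat q $ i $ j) =
      const (complex_of_real (antipode_coeff q i j)) * ST_mat q $ prime_idx i $ prime_idx j"
    unfolding ST_mat_eq[OF q]
    by (simp add: sp_star_def free_star_const_mult free_star_gen ST_mat_eq[OF q])
  also have "\<dots> = const (complex_of_real (antipode_coeff q i j * antipode_coeff q (prime_idx i) (prime_idx j)))
      * gen (j, i)"
    by (simp add: ST_mat_eq[OF q] const_hom(4) mult.assoc)
  also have "\<dots> = T_mat $ j $ i"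
    unfolding antipode_coeff_inverse[OF q] by (simp add: T_mat_def const_hom(2))
  finally show ?thesis .
qed

lemma sp_free_alg_eq: "sp_free_alg q = monoid_star_alg (sp_star q)"
  by (simp add: sp_free_alg_def sp_star_def)

lemma star_algebra_sp_free:
  assumes "q \<noteq> 0"
  shows "star_algebra (sp_free_alg q)"
  unfolding sp_free_alg_def
proof (rule star_algebra_free)
  fix x :: "idx \<times> idx"
  show "free_star (\<lambda>(i, j). ST_mat q $ j $ i) (case x of (i, j) \<Rightarrow> ST_mat q $ j $ i) = gen x"
    using sp_star_ST[OF assms] by (cases x) (simp add: sp_star_def T_mat_def)
qed

lemma sum_single_support:
  assumes "finite S" "\<And>x. \<lbrakk>x \<in> S; x \<noteq> u\<rbrakk> \<Longrightarrow> f x = 0"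
  shows "sum f S = (if u \<in> S then f u else 0)"
proof (cases "u \<in> S")
  case True
  then have "sum f S = f u + sum f (S - {u})"
    using assms(1) by (rule sum.remove[rotated])
  also have "sum f (S - {u}) = 0"
    using assms(2) by (intro sum.neutral) auto
  finally show ?thesis using True by simp
next
  case False
  then show ?thesis using assms(2) by (auto intro!: sum.neutral)
qed

lemma kron_unit_mat:
  "kron (unit_mat i j) (unit_mat k l) $ (a, b) $ (c, d) = (if a = i \<and> c = j \<and> b = k \<and> d = l then 1 else 0)"
  by (simp add: kron_def unit_mat_def)

text \<open>Each of the five sums defining \<open>R\<close> contributes at most one term to a given entry. The first three
  sums together form the diagonal.\<close>

lemma R_mat_entry:
  "R_mat q $ (i, j) $ (a, b) =
     (if i = a \<and> j = b then if i = j then q else if i = prime_idx j then q powi -1 else 1 else 0)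
   + (if i = b \<and> j = a \<and> pos i > pos a then q - q powi -1 else 0)
   - (if j = prime_idx i \<and> b = prime_idx a \<and> pos i > pos a
      then (q - q powi -1) * (q powi (rho i - rho a) * sgn_idx i * sgn_idx a) else 0)"
proof -
  have diag: "(\<Sum>k\<in>UNIV. kron (unit_mat k k) (unit_mat k k)) $ (i, j) $ (a, b) =
      (if i = a \<and> j = b \<and> i = j then 1 else 0 :: real)"
    unfolding sum_component kron_unit_mat by (subst sum_single_support[where u = i]) auto
  have neutral: "(\<Sum>(k, l) | k \<noteq> l \<and> k \<noteq> prime_idx l. kron (unit_mat k k) (unit_mat l l)) $ (i, j) $ (a, b) =
      (if i = a \<and> j = b \<and> i \<noteq> j \<and> i \<noteq> prime_idx j then 1 else 0 :: real)"
    unfolding sum_component case_prod_beta' kron_unit_mat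
    by (subst sum_single_support[where u = "(i, j)"]) (auto simp: kron_unit_mat)
  have anti: "(\<Sum>k\<in>UNIV. kron (unit_mat (prime_idx k) (prime_idx k)) (unit_mat k k)) $ (i, j) $ (a, b) =
      (if i = a \<and> j = b \<and> i = prime_idx j then 1 else 0 :: real)"
    unfolding sum_component kron_unit_mat by (subst sum_single_support[where u = j]) auto
  have exchange: "(\<Sum>(k, l) | pos k > pos l. kron (unit_mat k l) (unit_mat l k)) $ (i, j) $ (a, b) =
      (if i = b \<and> j = a \<and> pos i > pos a then 1 else 0 :: real)"
    unfolding sum_component case_prod_beta' kron_unit_mat
    by (subst sum_single_support[where u = "(i, a)"]) (auto simp: kron_unit_mat)
  have contraction: "(\<Sum>(k, l) | pos k > pos l. (q powi (rho k - rho l) * sgn_idx k * sgn_idx l) *\<^sub>R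
        kron (unit_mat k l) (unit_mat (prime_idx k) (prime_idx l))) $ (i, j) $ (a, b) =
      (if j = prime_idx i \<and> b = prime_idx a \<and> pos i > pos a
       then q powi (rho i - rho a) * sgn_idx i * sgn_idx a else 0)"
    unfolding sum_component case_prod_beta' kron_unit_mat
    by (subst sum_single_support[where u = "(i, a)"]) (auto simp: kron_unit_mat)
  have "(if i = a \<and> j = b then if i = j then q else if i = prime_idx j then q powi -1 else 1 else 0)
      = q * (if i = a \<and> j = b \<and> i = j then 1 else 0)
        + (if i = a \<and> j = b \<and> i \<noteq> j \<and> i \<noteq> prime_idx j then 1 else 0)
        + q powi -1 * (if i = a \<and> j = b \<and> i = prime_idx j then 1 else 0)"
    by (cases i; cases j) simp_all
  then show ?thesis
    unfolding R_mat_def vector_add_component vector_minus_component vector_scaleR_component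
      diag neutral anti exchange contraction
    by (simp only: real_scaleR_def if_distrib[where f = "(*) _"] mult_1_right mult_zero_right)
qed

text \<open>The transpose of \<open>R\<close> equals \<open>R\<^sub>2\<^sub>1\<close>, the conjugate of \<open>R\<close> by the flip of the tensor factors. In the last sum of \<open>R\<close> the transpose-flip
  replaces \<open>(i, j)\<close> by \<open>(j', i')\<close>, which preserves both \<open>\<rho>\<^sub>i - \<rho>\<^sub>j\<close> and the order of the indices.\<close>

lemma R_mat_flip_transpose: "R_mat q $ (b, a) $ (j, i) = R_mat q $ (i, j) $ (a, b)"
proof -
  have prime: "pos (prime_idx i) > pos (prime_idx a) \<longleftrightarrow> pos a > pos i"
    "sgn_idx (prime_idx i) * sgn_idx (prime_idx a) = sgn_idx i * sgn_idx a" for i a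
    by (cases i; cases a; simp)+
  have "(a = prime_idx b \<and> i = prime_idx j \<and> pos b > pos j) =
      (j = prime_idx i \<and> b = prime_idx a \<and> pos i > pos a)"
    using prime(1)[of a i] prime(1)[of b j] by (metis prime_idx_involutive)
  moreover have "(if j = prime_idx i \<and> b = prime_idx a \<and> pos i > pos a
        then (q - q powi -1) * (q powi (rho b - rho j) * sgn_idx b * sgn_idx j) else 0) =
      (if j = prime_idx i \<and> b = prime_idx a \<and> pos i > pos a
        then (q - q powi -1) * (q powi (rho i - rho a) * sgn_idx i * sgn_idx a) else 0)"
    using prime(2)[of i a] by (auto simp: prime rho_prime_idx mult.assoc mult.left_commute mult.commute)
  moreover have "(if b = j \<and> a = i then if b = a then q else if b = prime_idx a then q powi -1 else 1 else 0)
      = (if i = a \<and> j = b then if i = j then q else if i = prime_idx j then q powi -1 else 1 else 0)"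
    by (cases i; cases j) auto
  moreover have "(b = i \<and> a = j \<and> pos b > pos j) = (i = b \<and> j = a \<and> pos i > pos a)"
    by auto
  ultimately show ?thesis
    unfolding R_mat_entry by (simp only:)
qed

subsection \<open>The defining relations\<close>

lemma sp_ideal_two_sided: "two_sided_ideal (sp_ideal q)"
  unfolding sp_ideal_def sp_free_alg_eq by (rule genideal_two_sided)

interpretation sp: two_sided_ideal "sp_ideal q" for q
  by (rule sp_ideal_two_sided)

lemma sp_relation_in_ideal: "x \<in> sp_relations q \<Longrightarrow> x \<in> sp_ideal q"
  using genideal_subset[of "sp_relations q" "sp_star q"] by (auto simp: sp_ideal_def sp_free_alg_eq)

lemma RTT_cong:
  "sp.mat_cong q (lift_mat (R_mat q) ** T1_mat ** T2_mat) (T2_mat ** T1_mat ** lift_mat (R_mat q))"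
  unfolding sp.mat_cong_def
  by (intro allI sp_relation_in_ideal, unfold sp_relations_def, blast)+

lemma antipode_cong:
  "sp.mat_cong q (T_mat ** ST_mat q) (mat 1)" "sp.mat_cong q (ST_mat q ** T_mat) (mat 1)"
  unfolding sp.mat_cong_def
  by (intro allI sp_relation_in_ideal, unfold sp_relations_def, blast)+

lemma kron_mult_left_right:
  fixes M N :: "'a::ring_1^idx^idx"
  shows "(kron M (mat 1) ** kron (mat 1) N) $ r $ s = M $ fst r $ fst s * N $ snd r $ snd s"
  unfolding matrix_matrix_mult_def
  by (simp add: kron_def mat_def, subst sum_single_support[where u = "(fst s, snd r)"])
    (auto simp: prod_eq_iff)

lemma kron_mult_right_left:
  fixes M N :: "'a::ring_1^idx^idx"
  shows "(kron (mat 1) N ** kron M (mat 1)) $ r $ s = N $ snd r $ snd s * M $ fst r $ fst s"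
  unfolding matrix_matrix_mult_def
  by (simp add: kron_def mat_def, subst sum_single_support[where u = "(fst r, snd s)"])
    (auto simp: prod_eq_iff)

lemma kron_mult_left:
  fixes M N :: "'a::ring_1^idx^idx"
  shows "kron M (mat 1) ** kron N (mat 1) = kron (M ** N) (mat 1)"
proof -
  have "(\<Sum>z\<in>UNIV. M $ a $ fst z * (if b = snd z then 1 else 0) * (N $ fst z $ k * (if snd z = l then 1 else 0)))
      = (\<Sum>c\<in>UNIV. M $ a $ c * N $ c $ k) * (if b = l then 1 else 0)" for a k and b l :: idx
  proof -
    have "(\<Sum>z\<in>UNIV. M $ a $ fst z * (if b = snd z then 1 else 0) * (N $ fst z $ k * (if snd z = l then 1 else 0)))
      = (\<Sum>c\<in>UNIV. \<Sum>d\<in>UNIV. M $ a $ c * (if b = d then 1 else 0) * (N $ c $ k * (if d = l then 1 else 0)))"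
      by (simp add: sum.cartesian_product case_prod_beta' flip: UNIV_Times_UNIV)
    also have "\<dots> = (\<Sum>c\<in>UNIV. M $ a $ c * N $ c $ k * (if b = l then 1 else 0))"
      by (intro sum.cong refl, subst sum_single_support[where u = b]) auto
    finally show ?thesis by (simp add: sum_distrib_right)
  qed
  then show ?thesis
    by (simp add: vec_eq_iff kron_def mat_def matrix_matrix_mult_def)
qed

lemma kron_mult_right:
  fixes M N :: "'a::ring_1^idx^idx"
  shows "kron (mat 1) M ** kron (mat 1) N = kron (mat 1) (M ** N)"
proof -
  have "(\<Sum>z\<in>UNIV. (if a = fst z then 1 else 0) * M $ b $ snd z * ((if fst z = k then 1 else 0) * N $ snd z $ l))
      = (if a = k then 1 else 0) * (\<Sum>d\<in>UNIV. M $ b $ d * N $ d $ l)" for b l and a k :: idx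
  proof -
    have "(\<Sum>z\<in>UNIV. (if a = fst z then 1 else 0) * M $ b $ snd z * ((if fst z = k then 1 else 0) * N $ snd z $ l))
      = (\<Sum>d\<in>UNIV. \<Sum>c\<in>UNIV. (if a = c then 1 else 0) * M $ b $ d * ((if c = k then 1 else 0) * N $ d $ l))"
      by (subst sum.swap) (simp add: sum.cartesian_product case_prod_beta' flip: UNIV_Times_UNIV)
    also have "\<dots> = (\<Sum>d\<in>UNIV. (if a = k then 1 else 0) * (M $ b $ d * N $ d $ l))"
      by (intro sum.cong refl, subst sum_single_support[where u = a]) auto
    finally show ?thesis by (simp add: sum_distrib_left)
  qed
  then show ?thesis
    by (simp add: vec_eq_iff kron_def mat_def matrix_matrix_mult_def)
qed

lemma kron_mat_one: "kron (mat 1) (mat 1) = (mat 1 :: 'a::ring_1^(idx \<times> idx)^(idx \<times> idx))"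
  by (simp add: vec_eq_iff kron_def mat_def)

lemma sp_mat_cong_kron:
  assumes "sp.mat_cong q M N"
  shows "sp.mat_cong q (kron M (mat 1)) (kron N (mat 1))" "sp.mat_cong q (kron (mat 1) M) (kron (mat 1) N)"
proof -
  have "kron M (mat 1) $ r $ s - kron N (mat 1) $ r $ s = (M - N) $ fst r $ fst s * mat 1 $ snd r $ snd s"
    "kron (mat 1) M $ r $ s - kron (mat 1) N $ r $ s = mat 1 $ fst r $ fst s * (M - N) $ snd r $ snd s" for r s
    by (simp_all add: kron_def algebra_simps)
  then show "sp.mat_cong q (kron M (mat 1)) (kron N (mat 1))" "sp.mat_cong q (kron (mat 1) M) (kron (mat 1) N)"
    using assms sp.left sp.right by (simp_all add: sp.mat_cong_def)
qed

lemma RTT_left_entry: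
  "(lift_mat (R_mat q) ** T1_mat ** T2_mat) $ r $ s =
    (\<Sum>t\<in>UNIV. const (complex_of_real (R_mat q $ r $ t)) * (T_mat $ fst t $ fst s * T_mat $ snd t $ snd s))"
  unfolding matrix_mul_assoc[symmetric] T1_mat_def T2_mat_def
  by (simp add: matrix_matrix_mult_def[of "lift_mat (R_mat q)"] kron_mult_left_right)
    (simp add: lift_mat_def)

lemma RTT_right_entry:
  "(T2_mat ** T1_mat ** lift_mat (R_mat q)) $ r $ s =
    (\<Sum>t\<in>UNIV. T_mat $ snd r $ snd t * T_mat $ fst r $ fst t * const (complex_of_real (R_mat q $ t $ s)))"
  unfolding T1_mat_def T2_mat_def
  by (subst matrix_matrix_mult_def) (simp add: kron_mult_right_left lift_mat_def)

text \<open>Since \<open>S\<^sub>2 S\<^sub>1\<close> inverts \<open>T\<^sub>1 T\<^sub>2\<close> and \<open>S\<^sub>1 S\<^sub>2\<close> inverts \<open>T\<^sub>2 T\<^sub>1\<close>, multiplying \<open>R T\<^sub>1 T\<^sub>2 = T\<^sub>2 T\<^sub>1 R\<close> by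
  \<open>S\<^sub>1 S\<^sub>2\<close> on the left and by \<open>S\<^sub>2 S\<^sub>1\<close> on the right gives the claim.\<close>

lemma RSS_cong:
  fixes q
  defines "R \<equiv> lift_mat (R_mat q) :: sp_free^(idx \<times> idx)^(idx \<times> idx)"
    and "S1 \<equiv> kron (ST_mat q) (mat 1)" and "S2 \<equiv> kron (mat 1) (ST_mat q)"
  shows "sp.mat_cong q (S1 ** S2 ** R) (R ** S2 ** S1)"
proof -
  note cong = sp.mat_cong_mult sp.mat_cong_refl
  have S1T1: "sp.mat_cong q (S1 ** T1_mat) (mat 1)" and T1S1: "sp.mat_cong q (T1_mat ** S1) (mat 1)"
    and S2T2: "sp.mat_cong q (S2 ** T2_mat) (mat 1)" and T2S2: "sp.mat_cong q (T2_mat ** S2) (mat 1)"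
    unfolding S1_def S2_def T1_mat_def T2_mat_def kron_mult_left kron_mult_right
    using sp_mat_cong_kron[OF antipode_cong(1)] sp_mat_cong_kron[OF antipode_cong(2)]
    by (simp_all only: kron_mat_one)
  have "sp.mat_cong q (T1_mat ** (T2_mat ** S2) ** S1) (T1_mat ** mat 1 ** S1)"
    by (intro cong T2S2)
  also have "sp.mat_cong q (T1_mat ** mat 1 ** S1) (mat 1)"
    using T1S1 by simp
  finally have TTSS: "sp.mat_cong q (T1_mat ** (T2_mat ** S2) ** S1) (mat 1)" .
  have "sp.mat_cong q (S1 ** (S2 ** T2_mat) ** T1_mat) (S1 ** mat 1 ** T1_mat)"
    by (intro cong S2T2)
  also have "sp.mat_cong q (S1 ** mat 1 ** T1_mat) (mat 1)"
    using S1T1 by simp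
  finally have SSTT: "sp.mat_cong q (S1 ** (S2 ** T2_mat) ** T1_mat) (mat 1)" .
  have "sp.mat_cong q (S1 ** S2 ** R ** mat 1) (S1 ** S2 ** R ** (T1_mat ** (T2_mat ** S2) ** S1))"
    by (intro cong sp.mat_cong_sym[OF TTSS])
  also have "S1 ** S2 ** R ** (T1_mat ** (T2_mat ** S2) ** S1)
      = (S1 ** S2) ** (R ** T1_mat ** T2_mat) ** (S2 ** S1)"
    by (simp only: matrix_mul_assoc)
  also have "sp.mat_cong q \<dots> ((S1 ** S2) ** (T2_mat ** T1_mat ** R) ** (S2 ** S1))"
    unfolding R_def by (intro cong RTT_cong)
  also have "(S1 ** S2) ** (T2_mat ** T1_mat ** R) ** (S2 ** S1)
      = (S1 ** (S2 ** T2_mat) ** T1_mat) ** (R ** S2 ** S1)"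
    by (simp only: matrix_mul_assoc)
  also have "sp.mat_cong q \<dots> (mat 1 ** (R ** S2 ** S1))"
    by (intro cong SSTT)
  finally show ?thesis by simp
qed

text \<open>The adjoint of an entry of \<open>R T\<^sub>1 T\<^sub>2 - T\<^sub>2 T\<^sub>1 R\<close> is an entry of \<open>S\<^sub>1 S\<^sub>2 R - R S\<^sub>2 S\<^sub>1\<close> with the tensor factors
  exchanged; the symmetry of \<open>R\<close> compensates for this exchange.\<close>

lemma sp_star_ideal:
  assumes q: "q \<noteq> 0"
  shows "star_ideal (sp_free_alg q) (sp_ideal q)"
  unfolding sp_ideal_def sp_free_alg_eq
proof (rule star_ideal_genideal)
  show "star_algebra (monoid_star_alg (sp_star q))"
    using star_algebra_sp_free[OF q] by (simp add: sp_free_alg_eq)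
next
  let ?R = "lift_mat (R_mat q) :: sp_free^(idx \<times> idx)^(idx \<times> idx)" and ?S = "ST_mat q"
  let ?S1 = "kron ?S (mat 1)" and ?S2 = "kron (mat 1) ?S"
  note star_simps = free_star_diff free_star_sum free_star_mult free_star_const
  have lift: "?R $ r $ s = const (complex_of_real (R_mat q $ r $ s))" for r s
    by (simp add: lift_mat_def)
  have star_T: "free_star (\<lambda>(i, j). ST_mat q $ j $ i) (T_mat $ i $ j) = ?S $ j $ i" for i j
    using sp_star_T by (simp add: sp_star_def)
  have star_S: "free_star (\<lambda>(i, j). ST_mat q $ j $ i) (?S $ i $ j) = T_mat $ j $ i" for i j
    using sp_star_ST[OF q] by (simp add: sp_star_def)
  have star_RTT: "sp_star q ((?R ** T1_mat ** T2_mat - T2_mat ** T1_mat ** ?R) $ (i, j) $ (k, l)) =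
      (?S1 ** ?S2 ** ?R - ?R ** ?S2 ** ?S1) $ (l, k) $ (j, i)" for i j k l
  proof -
    let ?r = "\<lambda>a b. const (complex_of_real (R_mat q $ a $ b)) :: sp_free"
    have "(?R ** T1_mat ** T2_mat) $ (i, j) $ (k, l) =
        (\<Sum>r\<in>UNIV. ?r (i, j) r * (T_mat $ fst r $ k * T_mat $ snd r $ l))"
      by (simp add: RTT_left_entry)
    then have "sp_star q ((?R ** T1_mat ** T2_mat) $ (i, j) $ (k, l)) =
        (\<Sum>r\<in>UNIV. ?S $ l $ snd r * ?S $ k $ fst r * ?r (i, j) r)"
      by (simp add: sp_star_def star_simps star_T)
    also have "\<dots> = (\<Sum>r\<in>UNIV. ?S $ l $ fst r * ?S $ k $ snd r * ?r r (j, i))"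
      by (rule sum.reindex_bij_witness[of _ prod.swap prod.swap])
        (auto simp: R_mat_flip_transpose)
    also have "\<dots> = (?S1 ** ?S2 ** ?R) $ (l, k) $ (j, i)"
      by (subst (2) matrix_matrix_mult_def)
        (simp add: lift kron_mult_left_right)
    finally have left: "sp_star q ((?R ** T1_mat ** T2_mat) $ (i, j) $ (k, l)) =
        (?S1 ** ?S2 ** ?R) $ (l, k) $ (j, i)" .
    have "(T2_mat ** T1_mat ** ?R) $ (i, j) $ (k, l) =
        (\<Sum>r\<in>UNIV. T_mat $ j $ snd r * T_mat $ i $ fst r * ?r r (k, l))"
      by (simp add: RTT_right_entry)
    then have "sp_star q ((T2_mat ** T1_mat ** ?R) $ (i, j) $ (k, l)) =
        (\<Sum>r\<in>UNIV. ?r r (k, l) * (?S $ fst r $ i * ?S $ snd r $ j))"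
      by (simp add: sp_star_def star_simps star_T)
    also have "\<dots> = (\<Sum>r\<in>UNIV. ?r (l, k) r * (?S $ snd r $ i * ?S $ fst r $ j))"
      by (rule sum.reindex_bij_witness[of _ prod.swap prod.swap])
        (auto simp: R_mat_flip_transpose)
    also have "\<dots> = (?R ** ?S2 ** ?S1) $ (l, k) $ (j, i)"
      unfolding matrix_mul_assoc[symmetric]
      by (simp add: matrix_matrix_mult_def[of ?R] lift kron_mult_right_left)
    finally show ?thesis
      using left by (simp add: sp_star_def free_star_diff)
  qed
  have mat_one: "sp_star q (mat 1 $ i $ j) = mat 1 $ j $ i" for i j
    using free_star_one free_star_const[of _ 0]
    by (auto simp: sp_star_def mat_def const_hom(1))
  have star_TS: "sp_star q ((T_mat ** ?S - mat 1) $ i $ j) = (T_mat ** ?S - mat 1) $ j $ i" for i j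
    using mat_one[of i j]
    by (simp add: sp_star_def star_simps matrix_matrix_mult_def star_T star_S)
  have star_ST: "sp_star q ((?S ** T_mat - mat 1) $ i $ j) = (?S ** T_mat - mat 1) $ j $ i" for i j
    using mat_one[of i j]
    by (simp add: sp_star_def star_simps matrix_matrix_mult_def star_T star_S)
  fix x assume "x \<in> sp_relations q"
  then consider (RTT) i j k l where "x = (?R ** T1_mat ** T2_mat - T2_mat ** T1_mat ** ?R) $ (i, j) $ (k, l)"
    | (TS) i j where "x = (T_mat ** ?S - mat 1) $ i $ j"
    | (ST) i j where "x = (?S ** T_mat - mat 1) $ i $ j"
    unfolding sp_relations_def by (elim UnE CollectE exE conjE) (metis surj_pair)+
  then have "sp_star q x \<in> sp_ideal q"
  proof cases
    case RTT
    show ?thesis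
      using RSS_cong[of q] unfolding \<open>x = _\<close> star_RTT by (simp only: sp.mat_cong_def)
  next
    case TS
    show ?thesis
      using antipode_cong(1)[of q] unfolding \<open>x = _\<close> star_TS
      by (simp only: sp.mat_cong_def)
  next
    case ST
    show ?thesis
      using antipode_cong(2)[of q] unfolding \<open>x = _\<close> star_ST
      by (simp only: sp.mat_cong_def)
  qed
  then show "sp_star q x \<in> Idl\<^bsub>monoid_star_alg (sp_star q)\<^esub> sp_relations q"
    by (simp add: sp_ideal_def sp_free_alg_eq)
qed

subsection \<open>Commutation of the first and the last column\<close>

lemma sum_idx: "(\<Sum>i\<in>UNIV. f i) = f I1 + f I2 + f I3 + (f I4 :: 'a::comm_monoid_add)"
  by (simp add: UNIV_idx add.assoc)

lemma sum_idx_pair: "(\<Sum>r\<in>UNIV. f r) = (\<Sum>a\<in>UNIV. \<Sum>b\<in>UNIV. f (a :: idx, b :: idx) :: 'a::comm_monoid_add)"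
  by (simp add: sum.cartesian_product flip: UNIV_Times_UNIV)

abbreviation real_const :: "real \<Rightarrow> sp_free" where
  "real_const r \<equiv> const (complex_of_real r)"

text \<open>The entry of the quadratic relations in row \<open>(i, j)\<close> and column \<open>(4, 1)\<close>. Off the diagonal of \<open>R\<close>
  the first row index of a nonzero entry exceeds its first column index, so the only nonzero entry in this
  column is \<open>q\<^sup>-\<^sup>1\<close> and one side of the relation is a single product. Up to scalars the relation expresses a product of the form \<open>x\<^sub>k\<^sup>* x\<^sub>i\<close> through products \<open>x\<^sub>a x\<^sub>b\<^sup>*\<close>.\<close>

lemma column_commutation:
  assumes q: "q \<noteq> 0"
  shows "gen (j, I1) * gen (i, I4) -
      (\<Sum>r\<in>UNIV. real_const (q * R_mat q $ (i, j) $ r) * (gen (fst r, I4) * gen (snd r, I1))) \<in> sp_ideal q"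
    (is "_ - ?W \<in> _")
proof -
  have R41: "R_mat q $ r $ (I4, I1) = (if r = (I4, I1) then inverse q else 0)" for r
    by (cases r; cases "fst r"; cases "snd r") (simp_all add: R_mat_entry power_int_minus)
  have "(T2_mat ** T1_mat ** lift_mat (R_mat q)) $ (i, j) $ (I4, I1) =
      gen (j, I1) * gen (i, I4) * real_const (inverse q)"
    unfolding RTT_right_entry R41
    by (subst sum_single_support[where u = "(I4, I1)"]) (auto simp: T_mat_def const_hom(1))
  moreover have "(lift_mat (R_mat q) ** T1_mat ** T2_mat) $ (i, j) $ (I4, I1) =
      (\<Sum>r\<in>UNIV. real_const (R_mat q $ (i, j) $ r) * (gen (fst r, I4) * gen (snd r, I1)))" (is "_ = ?L")
    unfolding RTT_left_entry by (simp add: T_mat_def)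
  moreover have "(lift_mat (R_mat q) ** T1_mat ** T2_mat - T2_mat ** T1_mat ** lift_mat (R_mat q))
      $ (i, j) $ (I4, I1) \<in> sp_ideal q"
    using RTT_cong[of q] unfolding sp.mat_cong_def by blast
  ultimately have "?L - gen (j, I1) * gen (i, I4) * real_const (inverse q) \<in> sp_ideal q"
    by simp
  then have "- (real_const q * (?L - gen (j, I1) * gen (i, I4) * real_const (inverse q))) \<in> sp_ideal q"
    by (intro sp.uminus sp.left)
  moreover have "real_const q * (gen (j, I1) * gen (i, I4) * real_const (inverse q)) = gen (j, I1) * gen (i, I4)"
  proof -
    have "real_const q * real_const (inverse q) = real_const (q * inverse q)"
      by (simp add: const_hom(4))
    then have "real_const q * real_const (inverse q) = 1"
      using q by (simp add: const_hom(2))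
    moreover have "real_const q * (gen (j, I1) * gen (i, I4) * real_const (inverse q)) =
        real_const q * real_const (inverse q) * (gen (j, I1) * gen (i, I4))"
      by (metis const_central mult.assoc)
    ultimately show ?thesis by simp
  qed
  moreover have "real_const q * ?L = ?W"
    by (simp add: sum_distrib_left const_hom(4) mult.assoc)
  ultimately show ?thesis
    by (simp add: right_diff_distrib)
qed

text \<open>The ordered products \<open>x\<^sub>a T\<^sub>b\<^sup>1\<close>, into which all others are rewritten; \<open>T\<^sub>b\<^sup>1\<close> is up to a scalar the adjoint of
  \<open>x\<^sub>b\<^sub>'\<close>.\<close>

abbreviation col_word :: "idx \<Rightarrow> idx \<Rightarrow> sp_free" where
  "col_word a b \<equiv> gen (a, I4) * gen (b, I1)"

lemma R_mat_rows:
  assumes q: "q \<noteq> 0"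
  shows
    "q * R_mat q $ (I1, I4) $ r = (if r = (I1, I4) then 1 else 0)" (is ?A)
    "q * R_mat q $ (I2, I3) $ r =
      (if r = (I2, I3) then 1 else if r = (I1, I4) then - ((q^2 - 1) / q) else 0)" (is ?B)
    "q * R_mat q $ (I3, I2) $ r =
      (if r = (I3, I2) then 1 else if r = (I1, I4) then (q^2 - 1) / q^3
       else if r = (I2, I3) then (q^2 - 1) * (1 + 1 / q^2) else 0)" (is ?C)
    "q * R_mat q $ (I4, I1) $ r =
      (if r = (I4, I1) then 1 else if r = (I1, I4) then (q^2 - 1) * (1 + 1 / q^4)
       else if r = (I2, I3) then (q^2 - 1) / q^3 else if r = (I3, I2) then - ((q^2 - 1) / q) else 0)" (is ?D)
    "q * R_mat q $ (I2, I4) $ r = (if r = (I2, I4) then q else 0)" (is ?E)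
    "q * R_mat q $ (I4, I2) $ r =
      (if r = (I4, I2) then q else if r = (I2, I4) then q^2 - 1 else 0)" (is ?F)
proof -
  obtain a b where r: "r = (a, b)" by fastforce
  show ?A ?B ?C ?D ?E ?F
    unfolding r using q
    by (cases a; cases b; simp add: R_mat_entry power_int_minus; simp add: field_simps eval_nat_numeral)+
qed

lemma column_commutation_cases:
  assumes q: "q \<noteq> 0"
  shows
  "gen (I4, I1) * gen (I1, I4) - col_word I1 I4 \<in> sp_ideal q"
  "gen (I3, I1) * gen (I2, I4) - (col_word I2 I3 - real_const ((q^2 - 1) / q) * col_word I1 I4) \<in> sp_ideal q"
  "gen (I2, I1) * gen (I3, I4) - (col_word I3 I2 + real_const ((q^2 - 1) / q^3) * col_word I1 I4
     + real_const ((q^2 - 1) * (1 + 1 / q^2)) * col_word I2 I3) \<in> sp_ideal q"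
  "gen (I1, I1) * gen (I4, I4) - (col_word I4 I1 + real_const ((q^2 - 1) * (1 + 1 / q^4)) * col_word I1 I4
     + real_const ((q^2 - 1) / q^3) * col_word I2 I3 - real_const ((q^2 - 1) / q) * col_word I3 I2) \<in> sp_ideal q"
  "gen (I4, I1) * gen (I2, I4) - real_const q * col_word I2 I4 \<in> sp_ideal q"
  "gen (I2, I1) * gen (I4, I4) - (real_const q * col_word I4 I2 + real_const (q^2 - 1) * col_word I2 I4) \<in> sp_ideal q"
  using column_commutation[OF q, of I4 I1] column_commutation[OF q, of I3 I2]
    column_commutation[OF q, of I2 I3] column_commutation[OF q, of I1 I4]
    column_commutation[OF q, of I4 I2] column_commutation[OF q, of I2 I4]
  unfolding R_mat_rows[OF q] sum_idx_pair sum_idx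
  by (simp_all del: of_real_mult of_real_divide of_real_diff of_real_add add: const_hom(1,2,5) of_real_minus algebra_simps)

subsection \<open>The quantum seven-sphere\<close>

definition sp_class :: "real \<Rightarrow> sp_free \<Rightarrow> sp_free set" where
  "sp_class q f = sp_ideal q +>\<^bsub>sp_free_alg q\<^esub> f"

lemma sp_free_alg_simps [simp]:
  "carrier (sp_free_alg q) = UNIV" "f \<otimes>\<^bsub>sp_free_alg q\<^esub> g = f * g"
  "\<one>\<^bsub>sp_free_alg q\<^esub> = 1" "\<zero>\<^bsub>sp_free_alg q\<^esub> = 0" "f \<oplus>\<^bsub>sp_free_alg q\<^esub> g = f + g"
  "c \<odot>\<^bsub>sp_free_alg q\<^esub> f = const c * f" "star (sp_free_alg q) = sp_star q"
  "f \<ominus>\<^bsub>sp_free_alg q\<^esub> g = f - g"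
  by (simp_all add: sp_free_alg_eq)

lemma A_Sp_class:
  assumes q: "q \<noteq> 0"
  shows "carrier (A_Sp q) = range (sp_class q)"
    and "sp_class q f \<otimes>\<^bsub>A_Sp q\<^esub> sp_class q g = sp_class q (f * g)"
    and "sp_class q f \<oplus>\<^bsub>A_Sp q\<^esub> sp_class q g = sp_class q (f + g)"
    and "\<one>\<^bsub>A_Sp q\<^esub> = sp_class q 1" and "\<zero>\<^bsub>A_Sp q\<^esub> = sp_class q 0"
    and "c \<odot>\<^bsub>A_Sp q\<^esub> sp_class q f = sp_class q (const c * f)"
    and "star (A_Sp q) (sp_class q f) = sp_class q (sp_star q f)"
    and "sp_class q f = sp_class q g \<longleftrightarrow> f - g \<in> sp_ideal q"
    and "star_algebra (A_Sp q)"
proof -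
  interpret star_ideal "sp_free_alg q" "sp_ideal q"
    by (rule sp_star_ideal[OF q])
  show "carrier (A_Sp q) = range (sp_class q)"
    "sp_class q f \<otimes>\<^bsub>A_Sp q\<^esub> sp_class q g = sp_class q (f * g)"
    "sp_class q f \<oplus>\<^bsub>A_Sp q\<^esub> sp_class q g = sp_class q (f + g)"
    "\<one>\<^bsub>A_Sp q\<^esub> = sp_class q 1" "\<zero>\<^bsub>A_Sp q\<^esub> = sp_class q 0"
    "c \<odot>\<^bsub>A_Sp q\<^esub> sp_class q f = sp_class q (const c * f)"
    "star (A_Sp q) (sp_class q f) = sp_class q (sp_star q f)"
    "sp_class q f = sp_class q g \<longleftrightarrow> f - g \<in> sp_ideal q"
    by (simp_all add: A_Sp_def sp_class_def[abs_def] carrier_quot coset_hom smult_coset star_coset coset_eq_iff)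
  show "star_algebra (A_Sp q)"
    unfolding A_Sp_def by (rule star_algebra_quot)
qed

lemma A_S7_simps [simp]:
  "mult (A_S7 q) = mult (A_Sp q)" "one (A_S7 q) = one (A_Sp q)" "zero (A_S7 q) = zero (A_Sp q)"
  "add (A_S7 q) = add (A_Sp q)" "c \<odot>\<^bsub>A_S7 q\<^esub> x = c \<odot>\<^bsub>A_Sp q\<^esub> x" "star (A_S7 q) = star (A_Sp q)"
  by (simp_all add: A_S7_def)

lemma x_gen_class:
  assumes "q \<noteq> 0"
  shows "x_gen q i = sp_class q (T_mat $ i $ I4)" "xbar_gen q i = sp_class q (ST_mat q $ I4 $ i)"
proof -
  show "x_gen q i = sp_class q (T_mat $ i $ I4)"
    by (simp add: x_gen_def T_gen_def sp_class_def)
  then show "xbar_gen q i = sp_class q (ST_mat q $ I4 $ i)"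
    by (simp add: xbar_gen_def A_Sp_class[OF assms] sp_star_T)
qed

lemma star_x_gen:
  assumes "q \<noteq> 0"
  shows "star (A_Sp q) (x_gen q i) = xbar_gen q i" "star (A_Sp q) (xbar_gen q i) = x_gen q i"
  by (simp_all add: x_gen_class[OF assms] A_Sp_class[OF assms] sp_star_T sp_star_ST[OF assms])

lemma A_S7_star_algebra:
  assumes q: "q \<noteq> 0"
  shows "star_algebra (A_S7 q)"
    "x_gen q i \<in> carrier (A_S7 q)" "xbar_gen q i \<in> carrier (A_S7 q)"
proof -
  interpret star_algebra "A_Sp q" by (rule A_Sp_class(9)[OF q])
  have gens: "range (x_gen q) \<union> range (xbar_gen q) \<subseteq> carrier (A_Sp q)"
    unfolding A_Sp_class(1)[OF q] x_gen_class[OF q] by blast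
  show "star_algebra (A_S7 q)"
    unfolding A_S7_def
  proof (rule generated_star_algebra[OF gens])
    fix x assume "x \<in> range (x_gen q) \<union> range (xbar_gen q)"
    then obtain i where "x = x_gen q i \<or> x = xbar_gen q i" by blast
    then show "star (A_Sp q) x \<in> range (x_gen q) \<union> range (xbar_gen q)"
      using star_x_gen[OF q, of i] by auto
  qed
  show "x_gen q i \<in> carrier (A_S7 q)" "xbar_gen q i \<in> carrier (A_S7 q)"
    using generators_in_generated[of "range (x_gen q) \<union> range (xbar_gen q)"]
    unfolding A_S7_def by auto
qed

lemma v_mat_closed:
  assumes q: "q \<noteq> 0"
  shows "v_mat q i k \<in> carrier (A_S7 q)"
proof -
  interpret star_algebra "A_S7 q" by (rule A_S7_star_algebra(1)[OF q])
  have closed: "x \<in> carrier (A_S7 q) \<Longrightarrow> c \<odot>\<^bsub>A_S7 q\<^esub> x \<in> carrier (A_S7 q)" for c x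
    by (rule ops_closed(1))
  note scaled = closed[OF A_S7_star_algebra(2)[OF q]] closed[OF A_S7_star_algebra(3)[OF q]]
  show ?thesis
    by (cases i; cases k; simp only: v_mat.simps; rule scaled)
qed

fun v_free :: "real \<Rightarrow> idx \<Rightarrow> col \<Rightarrow> sp_free" where
  "v_free q I1 Col1 = real_const (q powi -3) * T_mat $ I1 $ I4"
| "v_free q I1 Col2 = real_const (q powi -2) * T_mat $ I2 $ I4"
| "v_free q I2 Col1 = real_const (- (q powi -1)) * ST_mat q $ I4 $ I2"
| "v_free q I2 Col2 = real_const (q powi -1) * ST_mat q $ I4 $ I1"
| "v_free q I3 Col1 = real_const (q powi -1) * T_mat $ I3 $ I4"
| "v_free q I3 Col2 = real_const (-1) * T_mat $ I4 $ I4"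
| "v_free q I4 Col1 = real_const (-1) * ST_mat q $ I4 $ I4"
| "v_free q I4 Col2 = real_const (-1) * ST_mat q $ I4 $ I3"

lemma v_mat_class:
  assumes q: "q \<noteq> 0"
  shows "v_mat q i k = sp_class q (v_free q i k)"
  by (cases i; cases k) (simp_all only: v_mat.simps v_free.simps A_S7_simps x_gen_class[OF q] A_Sp_class(6)[OF q])

lemma finsum_class:
  assumes q: "q \<noteq> 0" and "finite K" "\<And>k. k \<in> K \<Longrightarrow> sp_class q (f k) \<in> carrier (A_S7 q)"
  shows "(\<Oplus>\<^bsub>A_S7 q\<^esub>k\<in>K. sp_class q (f k)) = sp_class q (sum f K)"
proof -
  interpret star_algebra "A_S7 q" by (rule A_S7_star_algebra(1)[OF q])
  show ?thesis
    using assms(2,3)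
  proof (induction K rule: finite_induct)
    case empty
    then show ?case by (simp add: A_Sp_class(5)[OF q])
  next
    case (insert k K)
    then show ?case
      by (subst finsum_insert) (auto simp: A_Sp_class(3)[OF q])
  qed
qed

subsection \<open>The isometry and its projection\<close>

lemma real_const_mult:
  "real_const r * (real_const s * f) = real_const (r * s) * f"
  "(real_const r * f) * (real_const s * g) = real_const (r * s) * (f * g)"
proof -
  show "real_const r * (real_const s * f) = real_const (r * s) * f" for f
    by (simp add: const_hom(4) mult.assoc)
  then show "(real_const r * f) * (real_const s * g) = real_const (r * s) * (f * g)"
    by (simp only: mult.assoc const_left_commute[of f])
qed

text \<open>Linear combinations with explicit coefficient lists reduce identities between quadratic elements to
  identities between lists of rational functions of \<open>q\<close>.\<close>

fun lin_comb :: "sp_free list \<Rightarrow> real list \<Rightarrow> sp_free" where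
  "lin_comb (w # ws) (r # rs) = real_const r * w + lin_comb ws rs"
| "lin_comb _ _ = 0"

lemma lin_comb_add:
  "length rs = length ss \<Longrightarrow> lin_comb ws rs + lin_comb ws ss = lin_comb ws (map2 (+) rs ss)"
proof (induction rs ss arbitrary: ws rule: list_induct2)
  case (Cons r rs s ss)
  show ?case
  proof (cases ws)
    case (Cons w ws')
    then show ?thesis
      using Cons.IH[of ws'] by (simp add: const_hom(3) algebra_simps flip: Cons.IH)
  qed simp
qed simp

lemma lin_comb_scale: "real_const r * lin_comb ws rs = lin_comb ws (map ((*) r) rs)"
  by (induction ws rs rule: lin_comb.induct)
    (simp_all add: const_hom(4) distrib_left mult.assoc)

text \<open>The relation \<open>(ST)\<^sub>4\<^sup>4 = 1\<close> says \<open>\<Sum> x\<^sub>i\<^sup>* x\<^sub>i = 1\<close>, whereas the diagonal entries of \<open>v\<^sup>* v\<close> mix both orders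
  of \<open>x\<^sub>i\<close> and its adjoint. Correcting the unit relation by multiples of the commutation relations brings
  it to the shape of these entries; the entry off the diagonal needs commutation relations only, and
  the remaining one is its adjoint.\<close>

lemma v_free_isometry:
  assumes q: "q \<noteq> 0"
  shows "(\<Sum>i\<in>UNIV. sp_star q (v_free q i k) * v_free q i l) - (if k = l then 1 else 0) \<in> sp_ideal q"
proof -
  let ?x = "\<lambda>i. T_mat $ i $ I4" and ?y = "\<lambda>i. ST_mat q $ I4 $ i"
  have star_const: "sp_star q (real_const r * f) = real_const r * sp_star q f" for r f
    by (simp add: sp_star_def free_star_const_mult)
  note star_simps = star_const sp_star_T sp_star_ST[OF q]
  have y: "?y I1 = real_const (- (q^4)) * gen (I4, I1)" "?y I2 = real_const (- (q^3)) * gen (I3, I1)"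
    "?y I3 = real_const q * gen (I2, I1)" "?y I4 = real_const 1 * gen (I1, I1)"
    by (simp_all add: ST_mat_eq[OF q] antipode_coeff_def const_hom(2) del: of_real_power)
  have x: "?x i = gen (i, I4)" for i
    by (simp add: T_mat_def)
  have scale: "real_const r * f * (real_const s * g) = real_const (r * s) * (f * g)"
    "real_const r * (real_const s * f) = real_const (r * s) * f"
    "gen z * (real_const s * g) = real_const s * (gen z * g)"
    "real_const r * gen z * g = real_const r * (gen z * g)" for r s f g z
    using real_const_mult const_left_commute[of "gen z"] by (auto simp: mult.assoc)
  define F where "F k l = (\<Sum>i\<in>UNIV. sp_star q (v_free q i k) * v_free q i l)" for k l
  \<comment> \<open>The four products in the wrong order, the four in the right order, and the unit.\<close>
  define ws where "ws = [gen (I4, I1) * gen (I1, I4), gen (I3, I1) * gen (I2, I4),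
    gen (I2, I1) * gen (I3, I4), gen (I1, I1) * gen (I4, I4), col_word I1 I4, col_word I2 I3, col_word I3 I2, col_word I4 I1, 1]"
  define ws' where "ws' = [gen (I4, I1) * gen (I2, I4), gen (I2, I1) * gen (I4, I4), col_word I2 I4, col_word I4 I2]"
  note lin_simps = ws_def ws'_def lin_comb.simps const_hom(1,2,5)
  have "(\<Sum>i\<in>UNIV. ?y i * ?x i) - 1 \<in> sp_ideal q"
    using antipode_cong(2)[of q] unfolding sp.mat_cong_def
    by (auto simp: matrix_matrix_mult_def mat_def dest!: spec[of _ I4])
  moreover have "(\<Sum>i\<in>UNIV. ?y i * ?x i) - 1 = lin_comb ws [- (q^4), - (q^3), q, 1, 0, 0, 0, 0, -1]"
    unfolding sum_idx y x scale by (simp add: lin_simps)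
  ultimately have unit: "lin_comb ws [- (q^4), - (q^3), q, 1, 0, 0, 0, 0, -1] \<in> sp_ideal q"
    by simp
  have comm1: "lin_comb ws [1, 0, 0, 0, -1, 0, 0, 0, 0] \<in> sp_ideal q"
    using column_commutation_cases(1)[OF q] by (simp add: lin_simps)
  have to_lin_comb:
    "gen (I3, I1) * gen (I2, I4) - (col_word I2 I3 - real_const a * col_word I1 I4) = lin_comb ws [0, 1, 0, 0, a, -1, 0, 0, 0]"
    "gen (I2, I1) * gen (I3, I4) - (col_word I3 I2 + real_const a * col_word I1 I4 + real_const b * col_word I2 I3)
      = lin_comb ws [0, 0, 1, 0, - a, - b, -1, 0, 0]"
    "gen (I1, I1) * gen (I4, I4) - (col_word I4 I1 + real_const a * col_word I1 I4 + real_const b * col_word I2 I3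
      - real_const c * col_word I3 I2) = lin_comb ws [0, 0, 0, 1, - a, - b, c, -1, 0]" for a b c
    by (simp_all add: lin_simps algebra_simps)
  note comm2 = column_commutation_cases(2)[OF q, unfolded to_lin_comb]
  note comm3 = column_commutation_cases(3)[OF q, unfolded to_lin_comb]
  note comm4 = column_commutation_cases(4)[OF q, unfolded to_lin_comb]
  have comm5: "lin_comb ws' [1, 0, - q, 0] \<in> sp_ideal q"
    using column_commutation_cases(5)[OF q] by (simp add: lin_simps)
  have "gen (I2, I1) * gen (I4, I4) - (real_const q * col_word I4 I2 + real_const a * col_word I2 I4)
      = lin_comb ws' [0, 1, - a, - q]" for a
    by (simp add: lin_simps algebra_simps)
  note comm6 = column_commutation_cases(6)[OF q, unfolded this]
  have scaled: "lin_comb us rs \<in> sp_ideal q \<Longrightarrow> lin_comb us (map ((*) r) rs) \<in> sp_ideal q" for us rs r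
    using sp.left by (metis lin_comb_scale)
  have added: "\<lbrakk>lin_comb us rs \<in> sp_ideal q; lin_comb us ss \<in> sp_ideal q; length rs = length ss\<rbrakk>
      \<Longrightarrow> lin_comb us (map2 (+) rs ss) \<in> sp_ideal q" for us rs ss
    using sp.add by (metis lin_comb_add)
  have "F Col1 Col1 - 1 = lin_comb ws [- 1 / q^2, 0, 1 / q, 0, 0, - q, 0, 1, -1]"
    unfolding F_def sum_idx v_free.simps star_simps unfolding y x scale using q
    by (simp add: lin_simps power_int_minus field_simps eval_nat_numeral)
  also have "\<dots> \<in> sp_ideal q"
    \<comment> \<open>The multiples are determined by the coefficients of the four products in the wrong order.\<close>
    using added[OF added[OF added[OF added[OF unit scaled[OF comm1, of "q^4 - 1 / q^2"]]
          scaled[OF comm2, of "q^3"]] scaled[OF comm3, of "1 / q - q"]] scaled[OF comm4, of "-1"]]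
    using q by (simp add: field_simps eval_nat_numeral)
  finally have F11: "F Col1 Col1 - 1 \<in> sp_ideal q" .
  have "F Col2 Col2 - 1 = lin_comb ws [0, - 1 / q, 0, 1, - (q^2), 0, q, 0, -1]"
    unfolding F_def sum_idx v_free.simps star_simps unfolding y x scale using q
    by (simp add: lin_simps power_int_minus field_simps eval_nat_numeral)
  also have "\<dots> \<in> sp_ideal q"
    using added[OF added[OF added[OF unit scaled[OF comm1, of "q^4"]]
          scaled[OF comm2, of "q^3 - 1 / q"]] scaled[OF comm3, of "- q"]]
    using q by (simp add: field_simps eval_nat_numeral)
  finally have F22: "F Col2 Col2 - 1 \<in> sp_ideal q" .
  have "F Col1 Col2 = lin_comb ws' [- 1 / q, -1, q^2, q]"
    unfolding F_def sum_idx v_free.simps star_simps unfolding y x scale using q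
    by (simp add: lin_simps power_int_minus field_simps eval_nat_numeral)
  also have "\<dots> \<in> sp_ideal q"
    using added[OF scaled[OF comm5, of "- 1 / q"] scaled[OF comm6, of "-1"]]
    using q by (simp add: field_simps eval_nat_numeral)
  finally have F12: "F Col1 Col2 \<in> sp_ideal q" .
  interpret star_ideal "sp_free_alg q" "sp_ideal q"
    by (rule sp_star_ideal[OF q])
  have "sp_star q (F Col1 Col2) = F Col2 Col1"
    using star_star
    by (simp add: F_def sp_star_def free_star_sum free_star_mult)
  then have "F Col2 Col1 \<in> sp_ideal q"
    using star_in_ideal[OF F12] by simp
  then show ?thesis
    using F11 F22 F12 unfolding F_def by (cases k; cases l) simp_all
qed

lemma v_mat_isometry:
  assumes q: "q \<noteq> 0"
  shows "mat_mult (A_S7 q) (mat_star (A_S7 q) (v_mat q)) (v_mat q) = mat_one (A_S7 q)"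
proof (intro ext)
  fix k l
  interpret star_algebra "A_S7 q" by (rule A_S7_star_algebra(1)[OF q])
  let ?f = "\<lambda>i. sp_star q (v_free q i k) * v_free q i l"
  have entry: "mat_star (A_S7 q) (v_mat q) k i \<otimes>\<^bsub>A_S7 q\<^esub> v_mat q i l = sp_class q (?f i)" for i
    by (simp only: mat_star_def v_mat_class[OF q] A_S7_simps A_Sp_class(2,7)[OF q])
  have "mat_star (A_S7 q) (v_mat q) k i \<otimes>\<^bsub>A_S7 q\<^esub> v_mat q i l \<in> carrier (A_S7 q)" for i
    unfolding mat_star_def by (intro m_closed star_closed v_mat_closed q)
  then have "mat_mult (A_S7 q) (mat_star (A_S7 q) (v_mat q)) (v_mat q) k l = sp_class q (sum ?f UNIV)"
    unfolding mat_mult_def entry by (intro finsum_class q) simp_all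
  also have "\<dots> = sp_class q (if k = l then 1 else 0)"
    unfolding A_Sp_class(8)[OF q] by (rule v_free_isometry[OF q])
  also have "\<dots> = mat_one (A_S7 q) k l"
    by (simp add: mat_one_def A_Sp_class(4,5)[OF q])
  finally show "mat_mult (A_S7 q) (mat_star (A_S7 q) (v_mat q)) (v_mat q) k l = mat_one (A_S7 q) k l" .
qed

lemma p_mat_projection:
  assumes q: "q \<noteq> 0"
  shows "mat_star (A_S7 q) (p_mat q) = p_mat q" "mat_mult (A_S7 q) (p_mat q) (p_mat q) = p_mat q"
proof -
  interpret star_algebra "A_S7 q" by (rule A_S7_star_algebra(1)[OF q])
  show "mat_star (A_S7 q) (p_mat q) = p_mat q" "mat_mult (A_S7 q) (p_mat q) (p_mat q) = p_mat q"
    unfolding p_mat_def by (intro isometry_projection v_mat_closed v_mat_isometry q)+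
qed

lemma p_mat_closed:
  assumes q: "q \<noteq> 0"
  shows "p_mat q i j \<in> carrier (A_S7 q)"
proof -
  interpret star_algebra "A_S7 q" by (rule A_S7_star_algebra(1)[OF q])
  show ?thesis
    unfolding p_mat_def mat_star_def by (intro mat_mult_closed star_closed v_mat_closed q)
qed

lemma A_S4_subalgebra:
  assumes q: "q \<noteq> 0"
  shows "unital_subalgebra (carrier (A_S4 q)) (A_S7 q)" "star_algebra (A_S4 q)"
    "p_mat q i j \<in> carrier (A_S4 q)"
proof -
  interpret star_algebra "A_S7 q" by (rule A_S7_star_algebra(1)[OF q])
  have gens: "{p_mat q i j |i j. True} \<subseteq> carrier (A_S7 q)"
    using p_mat_closed[OF q] by blast
  show "unital_subalgebra (carrier (A_S4 q)) (A_S7 q)"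
    unfolding A_S4_def by (rule generated_unital_subalgebra[OF gens])
  show "star_algebra (A_S4 q)"
    unfolding A_S4_def
  proof (rule generated_star_algebra[OF gens])
    fix x assume "x \<in> {p_mat q i j |i j. True}"
    then obtain i j where x: "x = p_mat q i j" by blast
    have "star (A_S7 q) x = p_mat q j i"
      using fun_cong[OF fun_cong[OF p_mat_projection(1)[OF q]], of j i] by (simp only: x mat_star_def)
    then show "star (A_S7 q) x \<in> {p_mat q i j |i j. True}" by blast
  qed
  show "p_mat q i j \<in> carrier (A_S4 q)"
    using generators_in_generated[of "{p_mat q i j |i j. True}"]
    unfolding A_S4_def by blast
qed

section \<open>Polynomial functions on the four-sphere\<close>

lemma exhaust_5: "(k :: 5) = 0 \<or> k = 1 \<or> k = 2 \<or> k = 3 \<or> k = 4"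
proof (induct k)
  case (of_int z)
  then have "0 \<le> z" "z < 5" by simp_all
  then have "z = 0 \<or> z = 1 \<or> z = 2 \<or> z = 3 \<or> z = 4" by arith
  then show ?case by (elim disjE) simp_all
qed

lemma UNIV_5: "(UNIV :: 5 set) = {0, 1, 2, 3, 4}"
proof -
  have "k \<in> {0, 1, 2, 3, 4}" for k :: 5
    using exhaust_5[of k] by simp
  then show ?thesis by blast
qed

lemma sum_5: "(\<Sum>k\<in>UNIV. f (k :: 5)) = f 0 + f 1 + f 2 + f 3 + (f 4 :: 'a::comm_monoid_add)"
  unfolding UNIV_5 by (simp add: add.assoc)

lemma prod_5: "(\<Prod>k\<in>UNIV. f (k :: 5)) = f 0 * f 1 * f 2 * f 3 * (f 4 :: 'a::comm_monoid_mult)"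
  unfolding UNIV_5 by (simp add: mult.assoc)

text \<open>Every polynomial arises from constants by addition and by multiplication with a variable.\<close>

lemma poly5_induct [case_names const var add]:
  assumes const: "\<And>c. P (const c)" and var: "\<And>f k. P f \<Longrightarrow> P (f * y_var k)"
    and add: "\<And>f g. \<lbrakk>P f; P g\<rbrakk> \<Longrightarrow> P (f + g)"
  shows "P f"
proof (induction f rule: poly_mapping_single_induct)
  case (single m c)
  have "P f \<Longrightarrow> P (f * Poly_Mapping.single m 1)" for f
  proof (induction m arbitrary: f rule: poly_mapping_single_induct)
    case (single k n)
    have "P (f * y_var k ^ n)"
    proof (induction n)
      case (Suc n)
      have "f * y_var k ^ Suc n = f * y_var k ^ n * y_var k"
        by (simp only: power_Suc2 mult.assoc)
      then show ?case by (simp only: var[OF Suc])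
    qed (simp add: single.prems)
    moreover have "y_var k ^ n = Poly_Mapping.single (Poly_Mapping.single k n) 1"
      by (induction n) (simp_all add: y_var_def mult_single flip: single_add)
    ultimately show ?case by simp
  next
    case (add m n)
    then have "P (f * Poly_Mapping.single m 1 * Poly_Mapping.single n 1)"
      by blast
    then show ?case
      by (simp add: mult.assoc mult_single)
  qed
  from this[OF const[of c]] show ?case
    by (simp add: const_mult_single)
qed (rule add)

subsection \<open>Evaluation\<close>

locale poly5_evaluation =
  fixes \<iota> :: "complex \<Rightarrow> 'r::comm_ring_1" and Y :: "5 \<Rightarrow> 'r"
  assumes scalar_add: "\<iota> (c + d) = \<iota> c + \<iota> d" and scalar_mult: "\<iota> (c * d) = \<iota> c * \<iota> d"
    and scalar_one: "\<iota> 1 = 1"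
begin

definition eval :: "poly5 \<Rightarrow> 'r" where
  "eval = lin_ext (\<lambda>e c. \<iota> c * (\<Prod>k\<in>UNIV. Y k ^ Poly_Mapping.lookup e k))"

sublocale family: additive_family "\<lambda>e c. \<iota> c * (\<Prod>k\<in>UNIV. Y k ^ Poly_Mapping.lookup e k)"
  by unfold_locales (simp add: scalar_add distrib_right)

lemma eval_add: "eval (f + g) = eval f + eval g"
  by (simp add: eval_def family.lin_ext_add)

lemma eval_mult: "eval (f * g) = eval f * eval g"
  unfolding eval_def
  by (rule lin_ext_mult[where op = "(*)"])
    (simp_all add: family.additive_family_axioms scalar_mult lookup_add power_add prod.distrib
      distrib_left distrib_right)

lemma eval_const: "eval (const c) = \<iota> c"
  by (simp add: eval_def const_def)

lemma eval_var: "eval (y_var k) = Y k"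
proof -
  have "(\<Prod>j\<in>UNIV. Y j ^ Poly_Mapping.lookup (Poly_Mapping.single k 1) j) = (\<Prod>j\<in>UNIV. if j = k then Y j else 1)"
    by (intro prod.cong) (auto simp: lookup_single when_def)
  then show ?thesis
    by (simp add: eval_def y_var_def scalar_one)
qed

lemma eval_one: "eval 1 = 1"
  using eval_const[of 1] by (simp add: const_hom scalar_one)

lemma eval_diff: "eval (f - g) = eval f - eval g"
  using eval_add[of "f - g" g] by simp

lemma eval_sphere: "eval ((\<Sum>k\<in>UNIV. y_var k ^ 2) - 1) = (\<Sum>k\<in>UNIV. Y k ^ 2) - 1"
  by (simp add: eval_diff eval_add eval_mult eval_one eval_var sum_5 power2_eq_square)

end

interpretation complex_eval: poly5_evaluation "\<lambda>c. c" Y for Y :: "5 \<Rightarrow> complex"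
  by unfold_locales simp_all

subsection \<open>The involution and the sphere ideal\<close>

lemma map_cnj_lin_ext:
  "Poly_Mapping.map cnj f = lin_ext (\<lambda>m c. Poly_Mapping.single m (cnj c)) f"
proof (rule poly_mapping_eqI)
  fix m
  show "Poly_Mapping.lookup (Poly_Mapping.map cnj f) m =
      Poly_Mapping.lookup (lin_ext (\<lambda>m c. Poly_Mapping.single m (cnj c)) f) m"
    by (auto simp: lin_ext_def lookup_sum map.rep_eq lookup_single when_def in_keys_iff)
qed

interpretation map_cnj: additive_family "\<lambda>m c. Poly_Mapping.single m (cnj c)"
  by unfold_locales (simp add: single_add)

lemma map_cnj_add: "Poly_Mapping.map cnj (f + g) = Poly_Mapping.map cnj f + Poly_Mapping.map cnj g"
  by (simp add: map_cnj_lin_ext map_cnj.lin_ext_add)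

lemma map_cnj_single: "Poly_Mapping.map cnj (Poly_Mapping.single m c) = Poly_Mapping.single m (cnj c)"
  by (simp add: map_cnj_lin_ext)

lemma map_cnj_mult:
  "Poly_Mapping.map cnj (f * g :: 'm::comm_monoid_add \<Rightarrow>\<^sub>0 complex) = Poly_Mapping.map cnj f * Poly_Mapping.map cnj g"
  unfolding map_cnj_lin_ext
  by (rule lin_ext_mult[where op = "(*)"])
    (simp_all add: map_cnj.additive_family_axioms mult_single distrib_left distrib_right)

lemma map_cnj_y_var: "Poly_Mapping.map cnj (y_var k) = y_var k"
  by (simp add: y_var_def map_cnj_single)

lemma map_cnj_const: "Poly_Mapping.map cnj (const c) = const (cnj c)"
  by (simp add: const_def map_cnj_single)

lemma star_algebra_poly5: "star_algebra poly5_alg"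
  unfolding poly5_alg_def
proof (rule star_algebra_monoid_star_alg)
  fix f g :: poly5
  show "Poly_Mapping.map cnj (Poly_Mapping.map cnj f) = f"
    by (induction f rule: poly_mapping_single_induct) (simp_all add: map_cnj_single map_cnj_add)
  show "Poly_Mapping.map cnj (f * g) = Poly_Mapping.map cnj g * Poly_Mapping.map cnj f"
    by (simp add: map_cnj_mult mult.commute)
qed (simp_all add: map_cnj_add map_cnj_const)

definition sphere_ideal :: "poly5 set" where
  "sphere_ideal = Idl\<^bsub>poly5_alg\<^esub> {(\<Sum>k\<in>UNIV. y_var k ^ 2) - 1}"

interpretation sphere: two_sided_ideal sphere_ideal
  unfolding sphere_ideal_def poly5_alg_def by (rule genideal_two_sided)

lemma sphere_in_ideal: "(\<Sum>k\<in>UNIV. y_var k ^ 2) - 1 \<in> sphere_ideal"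
  using genideal_subset unfolding sphere_ideal_def poly5_alg_def by blast

lemma sphere_star_ideal: "star_ideal poly5_alg sphere_ideal"
  unfolding sphere_ideal_def poly5_alg_def
proof (rule star_ideal_genideal)
  show "star_algebra (monoid_star_alg (Poly_Mapping.map cnj :: poly5 \<Rightarrow> poly5))"
    using star_algebra_poly5 by (simp add: poly5_alg_def)
next
  fix f :: poly5 assume "f \<in> {(\<Sum>k\<in>UNIV. y_var k ^ 2) - 1}"
  moreover have "Poly_Mapping.map cnj ((\<Sum>k\<in>UNIV. y_var k ^ 2) - 1) + 1 = (\<Sum>k\<in>UNIV. y_var k ^ 2 :: poly5)"
    using map_cnj_add[of "(\<Sum>k\<in>UNIV. y_var k ^ 2) - 1 :: poly5" 1] map_cnj_const[of 1, where 'a = "5 \<Rightarrow>\<^sub>0 nat"]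
    by (simp add: const_hom sum_5 map_cnj_add map_cnj_mult map_cnj_y_var power2_eq_square)
  ultimately have "Poly_Mapping.map cnj f = f"
    by (metis add_diff_cancel_right' singletonD)
  then show "Poly_Mapping.map cnj f \<in> Idl\<^bsub>monoid_star_alg (Poly_Mapping.map cnj)\<^esub> {(\<Sum>k\<in>UNIV. y_var k ^ 2) - 1 :: poly5}"
    using \<open>f \<in> _\<close> genideal_subset by auto
qed

lemma eval_sphere_ideal:
  assumes "(\<Sum>k\<in>UNIV. Y k ^ 2) = 1" "poly5_evaluation \<iota>" "f \<in> sphere_ideal"
  shows "poly5_evaluation.eval \<iota> Y f = 0"
proof -
  interpret poly5_evaluation \<iota> Y by fact
  have "two_sided_ideal {f. eval f = 0}"
    by unfold_locales (simp_all add: eval_add eval_mult, use eval_diff[of 0 0] in simp)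
  then have "sphere_ideal \<subseteq> {f. eval f = 0}"
    unfolding sphere_ideal_def poly5_alg_def
    by (rule genideal_least) (simp add: eval_sphere assms)
  then show ?thesis using assms by blast
qed

subsection \<open>Normal forms\<close>

definition free_of_y4 :: "poly5 set" where
  "free_of_y4 = {f. \<forall>e\<in>Poly_Mapping.keys f. Poly_Mapping.lookup e 4 = 0}"

lemma free_of_y4_const: "const c \<in> free_of_y4"
  by (auto simp: free_of_y4_def const_def)

lemma free_of_y4_add: "\<lbrakk>f \<in> free_of_y4; g \<in> free_of_y4\<rbrakk> \<Longrightarrow> f + g \<in> free_of_y4"
  using keys_add[of f g] by (auto simp: free_of_y4_def)

lemma free_of_y4_mult: "\<lbrakk>f \<in> free_of_y4; g \<in> free_of_y4\<rbrakk> \<Longrightarrow> f * g \<in> free_of_y4"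
  using keys_mult[of f g] by (fastforce simp: free_of_y4_def lookup_add)

lemma free_of_y4_var: "k \<noteq> 4 \<Longrightarrow> y_var k \<in> free_of_y4"
  by (auto simp: free_of_y4_def y_var_def lookup_single when_def)

text \<open>Modulo the sphere relation \<open>y\<^sub>4\<^sup>2\<close> can be replaced by a polynomial in the other variables.\<close>

lemma sphere_normal_form:
  "\<exists>a\<in>free_of_y4. \<exists>b\<in>free_of_y4. f - (a + b * y_var 4) \<in> sphere_ideal"
proof (induction f rule: poly5_induct)
  case (const c)
  have "const c - (const c + const 0 * y_var 4) \<in> sphere_ideal"
    using sphere.zero by (simp add: const_hom)
  then show ?case
    using free_of_y4_const by blast
next
  case (add f g)
  then obtain a b a' b' where ab: "a \<in> free_of_y4" "b \<in> free_of_y4" "a' \<in> free_of_y4" "b' \<in> free_of_y4"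
    and "f - (a + b * y_var 4) \<in> sphere_ideal" "g - (a' + b' * y_var 4) \<in> sphere_ideal" by blast
  then have "f - (a + b * y_var 4) + (g - (a' + b' * y_var 4)) \<in> sphere_ideal"
    using sphere.add by blast
  moreover have "f - (a + b * y_var 4) + (g - (a' + b' * y_var 4)) = f + g - (a + a' + (b + b') * y_var 4)"
    by (simp add: algebra_simps)
  ultimately show ?case
    using ab free_of_y4_add by metis
next
  case (var f k)
  then obtain a b where ab: "a \<in> free_of_y4" "b \<in> free_of_y4"
    and "f - (a + b * y_var 4) \<in> sphere_ideal" by blast
  then have f: "(f - (a + b * y_var 4)) * y_var k \<in> sphere_ideal"
    using sphere.right by blast
  show ?case
  proof (cases "k = 4")
    case False
    moreover have "(f - (a + b * y_var 4)) * y_var k = f * y_var k - (a * y_var k + b * y_var k * y_var 4)"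
      by (simp add: algebra_simps)
    ultimately show ?thesis
      using f ab free_of_y4_mult free_of_y4_var by metis
  next
    case True
    define s where "s = 1 - (y_var 0 ^ 2 + y_var 1 ^ 2 + y_var 2 ^ 2 + y_var 3 ^ 2)"
    have "y_var k ^ 2 \<in> free_of_y4" if "k \<noteq> 4" for k
      using free_of_y4_mult free_of_y4_var that by (simp add: power2_eq_square)
    then have "const 1 + const (-1) * (y_var 0 ^ 2 + y_var 1 ^ 2 + y_var 2 ^ 2 + y_var 3 ^ 2) \<in> free_of_y4"
      by (intro free_of_y4_add free_of_y4_mult free_of_y4_const) simp_all
    then have s: "s \<in> free_of_y4"
      by (simp add: s_def const_hom algebra_simps)
    have "b * ((\<Sum>k\<in>UNIV. y_var k ^ 2) - 1) \<in> sphere_ideal"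
      by (rule sphere.left[OF sphere_in_ideal])
    then have "(f - (a + b * y_var 4)) * y_var k + b * ((\<Sum>k\<in>UNIV. y_var k ^ 2) - 1) \<in> sphere_ideal"
      using f sphere.add by blast
    moreover have "(f - (a + b * y_var 4)) * y_var k + b * ((\<Sum>k\<in>UNIV. y_var k ^ 2) - 1)
        = f * y_var k - (b * s + a * y_var 4)"
      unfolding sum_5 s_def True by (simp add: algebra_simps power2_eq_square)
    ultimately show ?thesis
      using ab s free_of_y4_mult by metis
  qed
qed

text \<open>The exponent of \<open>t\<close> in the monomial with exponents \<open>e\<close> after the Kronecker substitution \<open>y\<^sub>k = t ^ (N ^ k)\<close>
  for \<open>k < 4\<close>. Exponents smaller than \<open>N\<close> are its digits in base \<open>N\<close>, so distinct monomials remain distinct.\<close>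

definition kronecker_exponent :: "nat \<Rightarrow> (5 \<Rightarrow>\<^sub>0 nat) \<Rightarrow> nat" where
  "kronecker_exponent N e = Poly_Mapping.lookup e 0 + N * (Poly_Mapping.lookup e 1
     + N * (Poly_Mapping.lookup e 2 + N * Poly_Mapping.lookup e 3))"

lemma kronecker_exponent_inj:
  assumes "\<And>k. Poly_Mapping.lookup e k < N" "\<And>k. Poly_Mapping.lookup e' k < N"
    and "Poly_Mapping.lookup e 4 = 0" "Poly_Mapping.lookup e' 4 = 0"
    and "kronecker_exponent N e = kronecker_exponent N e'"
  shows "e = e'"
proof -
  have digit: "a = b \<and> x = y" if "a + N * x = b + N * y" "a < N" "b < N" for a b x y :: nat
  proof -
    have "a = (a + N * x) mod N" "b = (b + N * y) mod N" "x = (a + N * x) div N" "y = (b + N * y) div N"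
      using that(2,3) by simp_all
    then show ?thesis using that(1) by metis
  qed
  note lookups = assms(1,2)
  have d0: "Poly_Mapping.lookup e 0 = Poly_Mapping.lookup e' 0" and
    "Poly_Mapping.lookup e 1 + N * (Poly_Mapping.lookup e 2 + N * Poly_Mapping.lookup e 3) =
     Poly_Mapping.lookup e' 1 + N * (Poly_Mapping.lookup e' 2 + N * Poly_Mapping.lookup e' 3)"
    using digit[OF assms(5)[unfolded kronecker_exponent_def] lookups] by simp_all
  then have d1: "Poly_Mapping.lookup e 1 = Poly_Mapping.lookup e' 1" and
    "Poly_Mapping.lookup e 2 + N * Poly_Mapping.lookup e 3 =
     Poly_Mapping.lookup e' 2 + N * Poly_Mapping.lookup e' 3"
    using digit[OF _ lookups] by blast+
  then have "Poly_Mapping.lookup e 2 = Poly_Mapping.lookup e' 2" "Poly_Mapping.lookup e 3 = Poly_Mapping.lookup e' 3"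
    using digit[OF _ lookups] by blast+
  then have "Poly_Mapping.lookup e k = Poly_Mapping.lookup e' k" for k
    using d0 d1 assms(3,4) exhaust_5[of k] by metis
  then show ?thesis by (rule poly_mapping_eqI)
qed

text \<open>For \<open>0 < t < 1/2\<close> the points \<open>(t, t ^ N, t ^ N\<^sup>2, t ^ N\<^sup>3)\<close> lie in the box, and the Kronecker substitution turns
  \<open>f\<close> into a polynomial in \<open>t\<close> with the same coefficients and infinitely many roots.\<close>

lemma vanishing_on_box:
  assumes f: "f \<in> free_of_y4"
    and zero: "\<And>w :: 5 \<Rightarrow> real. (\<And>k. 0 < w k \<and> w k < 1 / 2) \<Longrightarrow> complex_eval.eval (\<lambda>k. complex_of_real (w k)) f = 0"
  shows "f = 0"
proof -
  let ?K = "Poly_Mapping.keys f"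
  define N where "N = Suc (\<Sum>e\<in>?K. \<Sum>k\<in>UNIV. Poly_Mapping.lookup e k)"
  have bound: "Poly_Mapping.lookup e k < N" if "e \<in> ?K" for e k
  proof -
    have "Poly_Mapping.lookup e k \<le> (\<Sum>k\<in>UNIV. Poly_Mapping.lookup e k)"
      by (rule member_le_sum) simp_all
    also have "\<dots> \<le> (\<Sum>e\<in>?K. \<Sum>k\<in>UNIV. Poly_Mapping.lookup e k)"
      using that by (intro member_le_sum) simp_all
    finally show ?thesis by (simp add: N_def)
  qed
  define A where "A = (\<Sum>e\<in>?K. monom (Poly_Mapping.lookup f e) (kronecker_exponent N e))"
  have "poly A (complex_of_real t) = 0" if t: "0 < t" "t < 1 / 2" for t
  proof -
    define T where "T = complex_of_real t"
    define w :: "5 \<Rightarrow> real" where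
      "w k = (if k = 0 then t else if k = 1 then t ^ N else if k = 2 then t ^ (N * N) else if k = 3 then t ^ (N * N * N) else t)" for k
    have "0 < t ^ n" "n > 0 \<Longrightarrow> t ^ n < 1 / 2" for n
    proof -
      assume "n > 0"
      then have "t ^ n \<le> t ^ 1" using t by (intro power_decreasing) auto
      then show "t ^ n < 1 / 2" using t by simp
    qed (use t in simp)
    note pow = this
    have "N > 0" by (simp add: N_def)
    then have "0 < w k \<and> w k < 1 / 2" for k
      using t pow[of N] pow[of "N * N"] pow[of "N * N * N"] unfolding w_def by auto
    then have "complex_eval.eval (\<lambda>k. complex_of_real (w k)) f = 0"
      by (rule zero)
    moreover have "(\<Prod>k\<in>UNIV. complex_of_real (w k) ^ Poly_Mapping.lookup e k) = T ^ kronecker_exponent N e"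
      if "e \<in> ?K" for e
    proof -
      have "Poly_Mapping.lookup e 4 = 0" using f that by (simp add: free_of_y4_def)
      then have "(\<Prod>k\<in>UNIV. complex_of_real (w k) ^ Poly_Mapping.lookup e k) =
          T ^ Poly_Mapping.lookup e 0 * (T ^ N) ^ Poly_Mapping.lookup e 1
          * (T ^ (N * N)) ^ Poly_Mapping.lookup e 2 * (T ^ (N * N * N)) ^ Poly_Mapping.lookup e 3"
        unfolding prod_5 by (simp add: w_def T_def)
      also have "\<dots> = T ^ kronecker_exponent N e"
        unfolding power_mult[symmetric] power_add[symmetric]
        by (simp add: kronecker_exponent_def algebra_simps)
      finally show ?thesis .
    qed
    ultimately show ?thesis
      by (simp add: complex_eval.eval_def lin_ext_def A_def poly_sum poly_monom flip: T_def)
  qed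
  then have "complex_of_real ` {0<..<1/2} \<subseteq> {x. poly A x = 0}"
    by auto
  moreover have "infinite (complex_of_real ` {0<..<1/2})"
    by (subst finite_image_iff) (auto simp: inj_on_def)
  ultimately have "A = 0"
    using poly_roots_finite finite_subset by blast
  have "Poly_Mapping.lookup f e = 0" if "e \<in> ?K" for e
  proof -
    have "kronecker_exponent N e' = kronecker_exponent N e \<longleftrightarrow> e' = e" if "e' \<in> ?K" for e'
      using kronecker_exponent_inj[of e' N e] bound f \<open>e \<in> ?K\<close> that by (auto simp: free_of_y4_def)
    then have "coeff A (kronecker_exponent N e) = (\<Sum>e'\<in>?K. if e' = e then Poly_Mapping.lookup f e' else 0)"
      unfolding A_def coeff_sum by (intro sum.cong) simp_all
    then show ?thesis
      using that \<open>A = 0\<close> by simp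
  qed
  then show ?thesis
    by (intro poly_mapping_eqI) (auto simp: in_keys_iff)
qed

text \<open>On the box \<open>0 < w\<^sub>k < 1/2\<close> the sum of four squares is below \<open>1\<close>, so each point of the box lies under two
  points \<open>y\<^sub>4 = \<plusminus> s\<close> of the sphere with \<open>0 < s < 1\<close>. From \<open>a + b s = 0 = a - b s\<close> both \<open>a\<close> and \<open>b\<close>
  vanish on the box. The bound \<open>w\<^sub>4 > -1\<close> leaves out the pole over which the later section of the
  Hopf fibration is undefined.\<close>

lemma vanishing_on_sphere:
  assumes zero: "\<And>w :: 5 \<Rightarrow> real. \<lbrakk>(\<Sum>k\<in>UNIV. w k ^ 2) = 1; w 4 > -1\<rbrakk> \<Longrightarrow> complex_eval.eval (\<lambda>k. complex_of_real (w k)) f = 0"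
  shows "f \<in> sphere_ideal"
proof -
  obtain a b where ab: "a \<in> free_of_y4" "b \<in> free_of_y4" and f: "f - (a + b * y_var 4) \<in> sphere_ideal"
    using sphere_normal_form by blast
  have "complex_eval.eval (\<lambda>k. complex_of_real (w k)) a = 0 \<and> complex_eval.eval (\<lambda>k. complex_of_real (w k)) b = 0"
    if w: "\<And>k. 0 < w k \<and> w k < 1 / 2" for w :: "5 \<Rightarrow> real"
  proof -
    define r where "r = w 0 ^ 2 + w 1 ^ 2 + w 2 ^ 2 + w 3 ^ 2"
    have sq: "w k ^ 2 < 1 / 4" "0 < w k ^ 2" for k
      using w[of k] power_strict_mono[of "w k" "1 / 2" 2] by (simp_all add: power2_eq_square)
    then have r: "0 < r" "r < 1"
      unfolding r_def using sq[of 0] sq[of 1] sq[of 2] sq[of 3] by linarith+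
    define s where "s = sqrt (1 - r)"
    have s: "0 < s" "s < 1" "s ^ 2 = 1 - r"
      using r by (simp_all add: s_def)
    have at: "complex_eval.eval (\<lambda>k. complex_of_real ((w(4 := t)) k)) f =
        complex_eval.eval (\<lambda>k. complex_of_real (w k)) a + complex_eval.eval (\<lambda>k. complex_of_real (w k)) b * of_real t"
        "complex_eval.eval (\<lambda>k. complex_of_real ((w(4 := t)) k)) f = 0" if "t ^ 2 = 1 - r" "t > -1" for t
    proof -
      let ?w = "\<lambda>k. complex_of_real ((w(4 := t)) k)"
      have unit: "(\<Sum>k\<in>UNIV. (w(4 := t)) k ^ 2) = 1"
        using that by (simp add: sum_5 r_def)
      then have "(\<Sum>k\<in>UNIV. ?w k ^ 2) = 1"
        by (simp flip: of_real_power of_real_sum)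
      then have "complex_eval.eval ?w (f - (a + b * y_var 4)) = 0"
        by (rule eval_sphere_ideal[OF _ complex_eval.poly5_evaluation_axioms f])
      moreover have "complex_eval.eval ?w g = complex_eval.eval (\<lambda>k. complex_of_real (w k)) g" if "g \<in> free_of_y4" for g
        using that unfolding complex_eval.eval_def lin_ext_def free_of_y4_def
        by (intro sum.cong refl) (simp add: prod_5)
      ultimately show "complex_eval.eval ?w f =
        complex_eval.eval (\<lambda>k. complex_of_real (w k)) a + complex_eval.eval (\<lambda>k. complex_of_real (w k)) b * of_real t"
        using ab by (simp add: complex_eval.eval_diff complex_eval.eval_add complex_eval.eval_mult complex_eval.eval_var)
      show "complex_eval.eval ?w f = 0"
        by (rule zero[OF unit]) (use that in simp)
    qed
    have "complex_eval.eval (\<lambda>k. complex_of_real (w k)) a + complex_eval.eval (\<lambda>k. complex_of_real (w k)) b * of_real s = 0"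
      "complex_eval.eval (\<lambda>k. complex_of_real (w k)) a + complex_eval.eval (\<lambda>k. complex_of_real (w k)) b * of_real (- s) = 0"
      using at[of s] at[of "- s"] s by simp_all
    then show ?thesis
      using s by (auto simp: add_eq_0_iff)
  qed
  then have "a = 0" "b = 0"
    using vanishing_on_box ab by blast+
  then show ?thesis
    using f by simp
qed

section \<open>The classical point\<close>

subsection \<open>Commutativity\<close>

lemma free_alg_induct [case_names const gen add]:
  fixes f :: "'x free_alg"
  assumes const: "\<And>c. P (const c)" and gen: "\<And>x f. P f \<Longrightarrow> P (gen x * f)"
    and add: "\<And>f g. \<lbrakk>P f; P g\<rbrakk> \<Longrightarrow> P (f + g)"
  shows "P f"
proof (induction f rule: poly_mapping_single_induct)
  case (single w c)
  have "P (Poly_Mapping.single (Word xs) c)" for xs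
  proof (induction xs)
    case Nil
    show ?case using const[of c] by (simp add: const_def zero_free_monoid_def)
  next
    case (Cons x xs)
    show ?case using gen[OF Cons, of x] by (simp add: gen_mult plus_free_monoid_def)
  qed
  then show ?case by (metis free_monoid.exhaust)
qed (rule add)

lemma R_mat_one: "R_mat 1 $ r $ s = (if r = s then 1 else 0)"
  by (cases r; cases s) (simp add: R_mat_entry)

lemma gen_commute: "gen x * gen y - gen y * gen x \<in> sp_ideal 1"
proof -
  obtain i k j l where xy: "x = (i, k)" "y = (j, l)" by (cases x; cases y) blast
  have "(lift_mat (R_mat 1) ** T1_mat ** T2_mat) $ (i, j) $ (k, l) = gen x * gen y"
    unfolding RTT_left_entry R_mat_one
    by (subst sum_single_support[where u = "(i, j)"]) (auto simp: xy T_mat_def const_hom)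
  moreover have "(T2_mat ** T1_mat ** lift_mat (R_mat 1)) $ (i, j) $ (k, l) = gen y * gen x"
    unfolding RTT_right_entry R_mat_one
    by (subst sum_single_support[where u = "(k, l)"]) (auto simp: xy T_mat_def const_hom)
  moreover have "(lift_mat (R_mat 1) ** T1_mat ** T2_mat - T2_mat ** T1_mat ** lift_mat (R_mat 1))
      $ (i, j) $ (k, l) \<in> sp_ideal 1"
    using RTT_cong[of 1] unfolding sp.mat_cong_def by blast
  ultimately show ?thesis by simp
qed

text \<open>Commutation with a generator extends from generators to products, then the same holds in the other argument.\<close>

lemma sp_commute: "f * g - g * f \<in> sp_ideal 1"
proof -
  have gen_g: "gen x * g - g * gen x \<in> sp_ideal 1" for x g
  proof (induction g rule: free_alg_induct)
    case (const c)
    show ?case by (simp add: const_central[of c "gen x"] sp.zero)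
  next
    case (gen y g)
    have "(gen x * gen y - gen y * gen x) * g + gen y * (gen x * g - g * gen x) \<in> sp_ideal 1"
      by (intro sp.add sp.left sp.right gen.IH gen_commute)
    moreover have "(gen x * gen y - gen y * gen x) * g + gen y * (gen x * g - g * gen x)
        = gen x * (gen y * g) - gen y * g * gen x"
      by (simp add: algebra_simps)
    ultimately show ?case by simp
  next
    case (add g h)
    then have "gen x * g - g * gen x + (gen x * h - h * gen x) \<in> sp_ideal 1"
      by (rule sp.add)
    then show ?case by (simp add: algebra_simps)
  qed
  show ?thesis
  proof (induction f rule: free_alg_induct)
    case (const c)
    show ?case by (simp add: const_central[of c g] sp.zero)
  next
    case (gen x f)
    have "gen x * (f * g - g * f) + (gen x * g - g * gen x) * f \<in> sp_ideal 1"
      by (intro sp.add sp.left sp.right gen.IH gen_g)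
    then show ?case by (simp add: algebra_simps)
  next
    case (add f h)
    then have "f * g - g * f + (h * g - g * h) \<in> sp_ideal 1"
      by (rule sp.add)
    then show ?case by (simp add: algebra_simps)
  qed
qed

subsection \<open>Characters\<close>

definition character :: "('x \<Rightarrow> complex) \<Rightarrow> 'x free_alg \<Rightarrow> complex" where
  "character M = lin_ext (\<lambda>w c. c * prod_list (map M (letters w)))"

interpretation character: additive_family "\<lambda>w c. c * prod_list (map M (letters w))"
  for M :: "'x \<Rightarrow> complex"
  by unfold_locales (simp add: distrib_right)

lemma character_add: "character M (f + g) = character M f + character M g"
  by (simp add: character_def character.lin_ext_add)

lemma character_mult: "character M (f * g) = character M f * character M g"
  unfolding character_def
  by (rule lin_ext_mult[where op = "(*)"])
    (simp_all add: character.additive_family_axioms plus_free_monoid_def distrib_left distrib_right)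

lemma character_const: "character M (const c) = c"
  by (simp add: character_def const_def zero_free_monoid_def)

lemma character_gen: "character M (gen x) = M x"
  by (simp add: character_def gen_def)

lemma character_zero: "character M 0 = 0" and character_one: "character M 1 = 1"
  using character_const[of M 0] character_const[of M 1] by (simp_all add: const_hom)

lemma character_diff: "character M (f - g) = character M f - character M g"
  using character_add[of M "f - g" g] by simp

lemma character_sum: "character M (sum f K) = (\<Sum>k\<in>K. character M (f k))"
  by (induction K rule: infinite_finite_induct) (simp_all add: character_zero character_add)

text \<open>A section of the Hopf fibration over the sphere minus a pole, lifted to unitary symplectic matrices. The last column is
  \<open>(r, 0, d k, v)\<close> with \<open>r\<^sup>2 + |v|\<^sup>2 = d\<^sup>2\<close> and \<open>d\<^sup>2 (1 + |k|\<^sup>2) = 1\<close>. The symplectic form then dictates the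
  first column, and the two middle columns are an orthonormal completion of the same shape; the parameter
  \<open>k\<close>, the quotient of the third entry by \<open>d\<close>, keeps all entries polynomial.\<close>

fun hopf_point :: "real \<Rightarrow> real \<Rightarrow> complex \<Rightarrow> complex \<Rightarrow> idx \<Rightarrow> idx \<Rightarrow> complex" where
  "hopf_point d r k v I1 I1 = cnj v" | "hopf_point d r k v I1 I2 = of_real r * cnj k"
| "hopf_point d r k v I1 I3 = - (cnj v * k)" | "hopf_point d r k v I1 I4 = of_real r"
| "hopf_point d r k v I2 I1 = of_real d * cnj k" | "hopf_point d r k v I2 I2 = 0"
| "hopf_point d r k v I2 I3 = of_real d" | "hopf_point d r k v I2 I4 = 0"
| "hopf_point d r k v I3 I1 = 0" | "hopf_point d r k v I3 I2 = - of_real d"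
| "hopf_point d r k v I3 I3 = 0" | "hopf_point d r k v I3 I4 = of_real d * k"
| "hopf_point d r k v I4 I1 = - of_real r" | "hopf_point d r k v I4 I2 = v * cnj k"
| "hopf_point d r k v I4 I3 = of_real r * k" | "hopf_point d r k v I4 I4 = v"

abbreviation hopf_character :: "real \<Rightarrow> real \<Rightarrow> complex \<Rightarrow> complex \<Rightarrow> sp_free \<Rightarrow> complex" where
  "hopf_character d r k v \<equiv> character (\<lambda>(i, j). hopf_point d r k v i j)"

lemma hopf_character_T: "hopf_character d r k v (T_mat $ i $ j) = hopf_point d r k v i j"
  by (simp add: T_mat_def character_gen)

lemma hopf_character_ST: "hopf_character d r k v (ST_mat 1 $ i $ j) = cnj (hopf_point d r k v j i)"
  by (cases i; cases j) (simp_all add: ST_mat_eq character_mult character_const character_gen antipode_coeff_def)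

text \<open>The equations that make \<open>hopf_point\<close> unitary, with the conjugates \<open>k'\<close> and \<open>v'\<close> as independent variables. They all
  arise from the two hypotheses by replacing \<open>d\<^sup>2\<close> with \<open>r\<^sup>2 + v v'\<close>.\<close>

lemma symplectic_identities:
  fixes d r k k' v v' :: complex
  assumes "r * r + v * v' = d * d" "d * d * (1 + k * k') = 1"
  shows "v' * v + r * k' * (r * k) + v' * k * (v * k') + r * r = 1" (is ?A)
    "d * k' * (d * k) + d * d = 1" (is ?B)
    "d * d + d * k * (d * k') = 1" (is ?C)
    "r * r + v * k' * (v' * k) + r * k * (r * k') + v * v' = 1" (is ?D)
    "v * v' + d * k * (d * k') + r * r = 1" (is ?E)
    "d * k * d - v * (v' * k) = r * (r * k)" (is ?F)
    "r * k * (r * k') + d * d + v' * k * (v * k') = 1" (is ?G)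
    "r * k * r - d * (d * k) + v' * k * v = 0" (is ?H)
    "d * (d * k') - v * k' * v' = r * k' * r" (is ?I)
    "v * k' * (v' * k) + d * d + r * k' * (r * k) = 1" (is ?J)
    "r * (r * k') - d * k' * d + v' * (v * k') = 0" (is ?K)
    "r * r + d * k' * (d * k) + v' * v = 1" (is ?L)
proof -
  have "d * d + d * d * (k * k') = 1"
    using assms(2) by (simp add: distrib_left)
  moreover from this have "r * r + v * v' + d * d * (k * k') = 1"
    and "d * d + (r * r + v * v') * (k * k') = 1" "r * r + v * v' + (r * r + v * v') * (k * k') = 1"
    by (simp_all only: assms(1))
  moreover have "d * d * k = (r * r + v * v') * k" "d * d * k' = (r * r + v * v') * k'"
    by (simp_all only: assms(1))
  ultimately show ?A ?B ?C ?D ?E ?F ?G ?H ?I ?J ?K ?L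
    by (simp_all add: algebra_simps)
qed

text \<open>At \<open>q = 1\<close> a matrix of complex numbers satisfies the quadratic relations trivially. The antipode acts on
  \<open>hopf_point\<close> as the conjugate transpose, so the remaining relations say that the matrix is unitary.\<close>

lemma hopf_character_sp_ideal:
  assumes unit: "of_real r * of_real r + v * cnj v = complex_of_real d * of_real d"
      "of_real d * of_real d * (1 + k * cnj k) = 1"
    and f: "f \<in> sp_ideal 1"
  shows "hopf_character d r k v f = 0"
proof -
  let ?\<chi> = "hopf_character d r k v"
  have "two_sided_ideal {f. ?\<chi> f = 0}"
    by unfold_locales (simp_all add: character_zero character_add character_mult)
  moreover have "?\<chi> f = 0" if "f \<in> sp_relations 1" for f
  proof -
    have RTT: "?\<chi> ((lift_mat (R_mat 1) ** T1_mat ** T2_mat - T2_mat ** T1_mat ** lift_mat (R_mat 1)) $ a $ b) = 0" for a b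
    proof -
      have "(lift_mat (R_mat 1) ** T1_mat ** T2_mat) $ a $ b = T_mat $ fst a $ fst b * T_mat $ snd a $ snd b"
        unfolding RTT_left_entry R_mat_one
        by (subst sum_single_support[where u = a]) (auto simp: const_hom)
      moreover have "(T2_mat ** T1_mat ** lift_mat (R_mat 1)) $ a $ b = T_mat $ snd a $ snd b * T_mat $ fst a $ fst b"
        unfolding RTT_right_entry R_mat_one
        by (subst sum_single_support[where u = b]) (auto simp: const_hom)
      ultimately show ?thesis
        by (simp add: character_diff character_mult)
    qed
    have one: "?\<chi> (mat 1 $ i $ j) = (if i = j then 1 else 0)" for i j
      by (simp add: mat_def character_one character_zero)
    have products: "(\<Sum>l\<in>UNIV. hopf_point d r k v i l * cnj (hopf_point d r k v j l)) = (if i = j then 1 else 0)"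
      "(\<Sum>l\<in>UNIV. cnj (hopf_point d r k v l i) * hopf_point d r k v l j) = (if i = j then 1 else 0)" for i j
      by (cases i; cases j; simp add: sum_idx; rule symplectic_identities[OF unit])+
    have TS: "?\<chi> ((T_mat ** ST_mat 1 - mat 1) $ i $ j) = 0" and ST: "?\<chi> ((ST_mat 1 ** T_mat - mat 1) $ i $ j) = 0" for i j
      using products[of i j] one[of i j]
      by (simp_all add: matrix_matrix_mult_def character_diff character_sum character_mult
          hopf_character_T hopf_character_ST)
    show ?thesis
      using that unfolding sp_relations_def
      by (elim UnE CollectE exE conjE) (simp_all only: RTT TS ST)
  qed
  ultimately have "sp_ideal 1 \<subseteq> {f. ?\<chi> f = 0}"
    unfolding sp_ideal_def sp_free_alg_eq by (intro genideal_least) auto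
  then show ?thesis using f by (auto dest: subsetD)
qed

lemma one_notin_sp_ideal: "1 \<notin> sp_ideal 1"
  using hopf_character_sp_ideal[of 1 0 1 0 1] by (auto simp: character_one)

subsection \<open>The classical coordinate ring as a type\<close>

text \<open>At \<open>q = 1\<close> the quotient is a single commutative ring, so it can be a type; evaluation of polynomials and calculations
  in a commutative ring then apply to it.\<close>

typedef coord = "carrier (A_Sp 1)"
  by (simp add: A_Sp_class(1))

definition coord :: "sp_free \<Rightarrow> coord" where
  "coord f = Abs_coord (sp_class 1 f)"

lemma Rep_coord_class: "Rep_coord (coord f) = sp_class 1 f"
  by (simp add: coord_def Abs_coord_inverse A_Sp_class(1))

lemma coord_eq_iff: "coord f = coord g \<longleftrightarrow> f - g \<in> sp_ideal 1"
  using A_Sp_class(8)[of 1 f g] by (metis Rep_coord_class Rep_coord_inject one_neq_zero)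

lemma coord_cases [cases type: coord]: obtains f where "x = coord f"
proof -
  have "Rep_coord x \<in> range (sp_class 1)"
    using Rep_coord[of x] A_Sp_class(1)[of 1] by simp
  then show ?thesis
    using that by (metis Rep_coord_class Rep_coord_inject imageE)
qed

instantiation coord :: comm_ring_1
begin

definition "0 = coord 0"
definition "1 = coord 1"
definition "x + y = Abs_coord (Rep_coord x \<oplus>\<^bsub>A_Sp 1\<^esub> Rep_coord y)"
definition "x * y = Abs_coord (Rep_coord x \<otimes>\<^bsub>A_Sp 1\<^esub> Rep_coord y)"
definition "- x = coord (- 1) * x"
definition "x - y = x + - (y :: coord)"

lemma coord_plus: "coord f + coord g = coord (f + g)"
  by (simp add: plus_coord_def Rep_coord_class A_Sp_class(3)) (simp add: coord_def)

lemma coord_times: "coord f * coord g = coord (f * g)"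
  by (simp add: times_coord_def Rep_coord_class A_Sp_class(2)) (simp add: coord_def)

lemma coord_uminus: "- coord f = coord (- f)"
  by (simp add: uminus_coord_def coord_times)

lemma coord_minus: "coord f - coord g = coord (f - g)"
  by (simp add: minus_coord_def coord_uminus coord_plus)

lemmas coord_ops = coord_plus coord_times coord_uminus coord_minus zero_coord_def one_coord_def

instance
proof
  fix x y z :: coord
  show "x + y + z = x + (y + z)" "x + y = y + x" "0 + x = x" "- x + x = 0" "x - y = x + - y"
    "x * y * z = x * (y * z)" "1 * x = x" "(x + y) * z = x * z + y * z"
    by (cases x; cases y; cases z; simp add: coord_ops algebra_simps)+
  show "x * y = y * x"
    by (cases x; cases y; simp add: coord_ops coord_eq_iff sp_commute)
  show "(0 :: coord) \<noteq> 1"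
    using one_notin_sp_ideal sp.uminus[of "-1" 1] by (auto simp: coord_ops coord_eq_iff)
qed

end

lemma Rep_coord_hom:
  "Rep_coord (x + y) = Rep_coord x \<oplus>\<^bsub>A_Sp 1\<^esub> Rep_coord y"
  "Rep_coord (x * y) = Rep_coord x \<otimes>\<^bsub>A_Sp 1\<^esub> Rep_coord y"
  "Rep_coord 1 = \<one>\<^bsub>A_Sp 1\<^esub>"
  by (cases x; cases y; simp add: coord_ops Rep_coord_class A_Sp_class(2,3,4))+

definition scalar :: "complex \<Rightarrow> coord" where
  "scalar c = coord (const c)"

lemma Rep_coord_scalar: "Rep_coord (scalar c * x) = c \<odot>\<^bsub>A_Sp 1\<^esub> Rep_coord x"
  by (cases x) (simp add: scalar_def coord_ops Rep_coord_class A_Sp_class(6))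

lemma scalar_hom:
  "scalar (c + d) = scalar c + scalar d" "scalar (c * d) = scalar c * scalar d" "scalar 1 = 1"
  "scalar (- c) = - scalar c"
  by (simp_all add: scalar_def coord_ops const_hom)

definition coord_star :: "coord \<Rightarrow> coord" where
  "coord_star x = Abs_coord (star (A_Sp 1) (Rep_coord x))"

lemma coord_star_class: "coord_star (coord f) = coord (sp_star 1 f)"
  by (simp add: coord_star_def Rep_coord_class A_Sp_class(7)) (simp add: coord_def)

lemma Rep_coord_star: "Rep_coord (coord_star x) = star (A_Sp 1) (Rep_coord x)"
  by (cases x) (simp add: coord_star_class Rep_coord_class A_Sp_class(7))

lemma coord_star_hom:
  "coord_star (x + y) = coord_star x + coord_star y"
  "coord_star (x - y) = coord_star x - coord_star y"
  "coord_star (x * y) = coord_star x * coord_star y"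
  "coord_star (scalar c) = scalar (cnj c)" "coord_star 1 = 1" "coord_star (- x) = - coord_star x"
proof -
  show add: "coord_star (x + y) = coord_star x + coord_star y" for x y
    by (cases x; cases y; simp add: coord_ops coord_star_class sp_star_def free_star_add)
  show "coord_star (x - y) = coord_star x - coord_star y"
    using add[of "x - y" y] by simp
  have "coord_star 0 = 0"
    using add[of 0 0] by simp
  then show "coord_star (- x) = - coord_star x"
    using add[of "- x" x] by (simp add: eq_neg_iff_add_eq_0)
  have "coord_star (x * y) = coord_star y * coord_star x"
    by (cases x; cases y; simp add: coord_ops coord_star_class sp_star_def free_star_mult)
  then show "coord_star (x * y) = coord_star x * coord_star y"
    by (simp only: mult.commute)
  show "coord_star (scalar c) = scalar (cnj c)" for c
    by (simp add: scalar_def coord_star_class sp_star_def free_star_const)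
  from this[of 1] show "coord_star 1 = 1"
    by (simp add: scalar_hom)
qed

lemma coord_star_star: "coord_star (coord_star x) = x"
proof -
  interpret star_algebra "A_Sp 1" by (rule A_Sp_class(9)) simp
  show ?thesis
    by (metis Rep_coord Rep_coord_inject Rep_coord_star star_star)
qed

subsection \<open>The projection and the coordinates of the four-sphere\<close>

text \<open>The entries of \<open>v\<close>, and below those of \<open>p\<close> and the \<open>x\<^sub>i\<close>, as elements of this ring.\<close>

definition v_coord :: "idx \<Rightarrow> col \<Rightarrow> coord" where
  "v_coord i k = coord (v_free 1 i k)"

definition proj :: "idx \<Rightarrow> idx \<Rightarrow> coord" where
  "proj i j = v_coord i Col1 * coord_star (v_coord j Col1) + v_coord i Col2 * coord_star (v_coord j Col2)"

lemma Rep_coord_proj: "Rep_coord (proj i j) = p_mat 1 i j"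
proof -
  interpret star_algebra "A_S7 1" by (rule A_S7_star_algebra(1)) simp
  have rep_v: "Rep_coord (v_coord i k) = v_mat 1 i k" for i k
    by (simp add: v_coord_def Rep_coord_class v_mat_class)
  have "v_mat 1 i k \<otimes>\<^bsub>A_S7 1\<^esub> star (A_S7 1) (v_mat 1 j k) \<in> carrier (A_S7 1)" for k
    by (intro m_closed star_closed v_mat_closed) simp_all
  then have "p_mat 1 i j = (v_mat 1 i Col1 \<otimes>\<^bsub>A_S7 1\<^esub> star (A_S7 1) (v_mat 1 j Col1))
      \<oplus>\<^bsub>A_S7 1\<^esub> (v_mat 1 i Col2 \<otimes>\<^bsub>A_S7 1\<^esub> star (A_S7 1) (v_mat 1 j Col2))"
    unfolding p_mat_def mat_mult_def mat_star_def UNIV_col by (simp del: v_mat.simps A_S7_simps)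
  then show ?thesis
    by (simp only: proj_def Rep_coord_hom Rep_coord_star rep_v A_S7_simps)
qed

definition x_coord :: "idx \<Rightarrow> coord" where
  "x_coord i = coord (T_mat $ i $ I4)"

lemma star_x_coord: "coord_star (x_coord i) = coord (ST_mat 1 $ I4 $ i)"
  by (simp add: x_coord_def coord_star_class sp_star_T)

lemma v_coord_eq:
  "v_coord I1 Col1 = x_coord I1" "v_coord I1 Col2 = x_coord I2" "v_coord I2 Col1 = - coord_star (x_coord I2)" "v_coord I2 Col2 = coord_star (x_coord I1)"
  "v_coord I3 Col1 = x_coord I3" "v_coord I3 Col2 = - x_coord I4" "v_coord I4 Col1 = - coord_star (x_coord I4)" "v_coord I4 Col2 = - coord_star (x_coord I3)"
  unfolding star_x_coord by (simp_all add: v_coord_def x_coord_def coord_uminus const_hom)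

lemma x_coord_unit:
  "coord_star (x_coord I1) * x_coord I1 + coord_star (x_coord I2) * x_coord I2 + coord_star (x_coord I3) * x_coord I3 + coord_star (x_coord I4) * x_coord I4 = 1"
proof -
  have "(ST_mat 1 ** T_mat - mat 1) $ I4 $ I4 \<in> sp_ideal 1"
    using antipode_cong(2)[of 1] unfolding sp.mat_cong_def by blast
  then have "coord ((ST_mat 1 ** T_mat) $ I4 $ I4) = 1"
    by (simp add: one_coord_def coord_eq_iff mat_def)
  then show ?thesis
    unfolding star_x_coord unfolding x_coord_def by (simp add: matrix_matrix_mult_def sum_idx coord_times coord_plus)
qed

text \<open>Twice the real and imaginary parts of \<open>p\<^sub>1\<^sub>3\<close> and \<open>p\<^sub>1\<^sub>4\<close>, and \<open>2 p\<^sub>1\<^sub>1 - 1\<close>: the coefficients of \<open>2 p - 1\<close>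
  with respect to Hermitian matrices that generate a Clifford algebra.\<close>

definition sphere_coord :: "5 \<Rightarrow> coord" where
  "sphere_coord k =
    (if k = 0 then proj I1 I3 + proj I3 I1
     else if k = 1 then scalar (- \<i>) * (proj I1 I3 - proj I3 I1)
     else if k = 2 then proj I1 I4 + proj I4 I1
     else if k = 3 then scalar (- \<i>) * (proj I1 I4 - proj I4 I1)
     else 2 * proj I1 I1 - 1)"

lemma star_proj: "coord_star (proj i j) = proj j i"
  by (simp add: proj_def coord_star_hom coord_star_star mult.commute)

lemma star_sphere_coord: "coord_star (sphere_coord k) = sphere_coord k"
proof -
  have "coord_star 2 = 2"
    using coord_star_hom(1)[of 1 1] by (simp add: coord_star_hom)
  then show ?thesis
    by (simp add: sphere_coord_def coord_star_hom star_proj scalar_hom algebra_simps)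
qed

lemma scalar_i: "scalar \<i> * scalar \<i> = - 1"
  by (simp add: scalar_hom(3,4) flip: scalar_hom(2))

text \<open>With \<open>\<alpha> = p\<^sub>1\<^sub>1 = |x\<^sub>1|\<^sup>2 + |x\<^sub>2|\<^sup>2\<close> the multiplicativity of the quaternion norm gives
  \<open>|p\<^sub>1\<^sub>3|\<^sup>2 + |p\<^sub>1\<^sub>4|\<^sup>2 = \<alpha> (1 - \<alpha>)\<close>, and \<open>4 \<alpha> (1 - \<alpha>) + (2 \<alpha> - 1)\<^sup>2 = 1\<close>.\<close>

lemma sphere_coord_unit: "(\<Sum>k\<in>UNIV. sphere_coord k ^ 2) = 1"
proof -
  define a b c d a' b' c' d' where defs: "a = x_coord I1" "b = x_coord I2" "c = x_coord I3" "d = x_coord I4"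
    "a' = coord_star (x_coord I1)" "b' = coord_star (x_coord I2)" "c' = coord_star (x_coord I3)" "d' = coord_star (x_coord I4)"
  have proj: "proj I1 I1 = a * a' + b * b'" "proj I1 I3 = a * c' - b * d'" "proj I3 I1 = c * a' - d * b'"
    "proj I1 I4 = - (a * d + b * c)" "proj I4 I1 = - (d' * a' + c' * b')"
    by (simp_all add: proj_def v_coord_eq coord_star_hom coord_star_star defs algebra_simps)
  have "c * c' + d * d' = 1 - (a * a' + b * b')"
    using x_coord_unit by (simp add: defs algebra_simps)
  moreover have "(a * c' - b * d') * (c * a' - d * b') + (a * d + b * c) * (d' * a' + c' * b')
      = (a * a' + b * b') * (c * c' + d * d')"
    by (simp add: algebra_simps)
  ultimately have norm: "proj I1 I3 * proj I3 I1 + proj I1 I4 * proj I4 I1 = proj I1 I1 * (1 - proj I1 I1)"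
    by (simp only: proj minus_mult_minus)
  have sq: "(x + y) ^ 2 + (scalar (- \<i>) * (x - y)) ^ 2 = 4 * (x * y)" for x y :: coord
  proof -
    have "(scalar (- \<i>) * (x - y)) ^ 2 = scalar \<i> * scalar \<i> * (x - y) ^ 2"
      by (simp add: scalar_hom(4) power2_eq_square algebra_simps)
    then show ?thesis
      by (simp add: scalar_i power2_eq_square algebra_simps)
  qed
  have "(\<Sum>k\<in>UNIV. sphere_coord k ^ 2) = 4 * (proj I1 I3 * proj I3 I1) + 4 * (proj I1 I4 * proj I4 I1)
      + (2 * proj I1 I1 - 1) ^ 2"
    using sq[of "proj I1 I3" "proj I3 I1"] sq[of "proj I1 I4" "proj I4 I1"]
    by (simp add: sum_5 sphere_coord_def add.assoc)
  also have "\<dots> = 4 * (proj I1 I1 * (1 - proj I1 I1)) + (2 * proj I1 I1 - 1) ^ 2"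
    by (simp only: norm[symmetric] distrib_left)
  also have "\<dots> = 1"
    by (simp add: power2_eq_square algebra_simps)
  finally show ?thesis .
qed

subsection \<open>Polynomial functions of the coordinates\<close>

interpretation sphere_eval: poly5_evaluation scalar sphere_coord
  by unfold_locales (simp_all add: scalar_hom)

lemma coord_star_eval: "coord_star (sphere_eval.eval f) = sphere_eval.eval (Poly_Mapping.map cnj f)"
  by (induction f rule: poly5_induct)
    (simp_all add: sphere_eval.eval_const sphere_eval.eval_mult sphere_eval.eval_add sphere_eval.eval_var
      coord_star_hom star_sphere_coord map_cnj_const map_cnj_mult map_cnj_y_var map_cnj_add)

lemma scalar_half: "scalar (1 / 2) * (2 * x) = x"
proof -
  have "scalar (1 / 2) * 2 = scalar (1 / 2) + scalar (1 / 2)"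
    by simp
  also have "\<dots> = 1"
    by (simp add: scalar_hom(3) flip: scalar_hom(1))
  finally show ?thesis
    by (simp flip: mult.assoc)
qed

text \<open>The quaternionic shape of \<open>v\<close> makes the two diagonal blocks of \<open>p\<close> scalar, \<open>p\<^sub>1\<^sub>1\<close> and \<open>1 - p\<^sub>1\<^sub>1\<close>, and expresses
  the off-diagonal block through \<open>p\<^sub>1\<^sub>3\<close>, \<open>p\<^sub>1\<^sub>4\<close> and their adjoints.\<close>

lemma proj_in_range: "proj i j \<in> range sphere_eval.eval"
proof -
  let ?R = "range sphere_eval.eval"
  have add: "x + y \<in> ?R" if "x \<in> ?R" "y \<in> ?R" for x y
  proof -
    from that obtain f g where "x = sphere_eval.eval f" "y = sphere_eval.eval g" by blast
    then have "x + y = sphere_eval.eval (f + g)" by (simp add: sphere_eval.eval_add)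
    then show ?thesis by blast
  qed
  have mult: "x * y \<in> ?R" if "x \<in> ?R" "y \<in> ?R" for x y
  proof -
    from that obtain f g where "x = sphere_eval.eval f" "y = sphere_eval.eval g" by blast
    then have "x * y = sphere_eval.eval (f * g)" by (simp add: sphere_eval.eval_mult)
    then show ?thesis by blast
  qed
  have scalar: "scalar c \<in> ?R" for c
    using sphere_eval.eval_const[of c, symmetric] by blast
  have coord: "sphere_coord k \<in> ?R" for k
    using sphere_eval.eval_var[of k, symmetric] by blast
  have one: "1 \<in> ?R" and zero: "0 \<in> ?R"
    using scalar[of 1] scalar[of 0] by (simp_all add: scalar_hom(3), simp add: scalar_def zero_coord_def const_hom)
  have neg: "- x \<in> ?R" if "x \<in> ?R" for x
    using mult[OF scalar[of "- 1"] that] by (simp add: scalar_hom)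
  have i: "scalar \<i> * (scalar (- \<i>) * x) = x" for x
    by (simp add: scalar_hom(3) flip: scalar_hom(2) mult.assoc)
  have half: "scalar (1 / 2) * (x + y + (x - y)) = x" "scalar (1 / 2) * (x + y - (x - y)) = y" for x y
    using scalar_half[of x] scalar_half[of y] by simp_all
  have "proj I1 I3 = scalar (1 / 2) * (sphere_coord 0 + scalar \<i> * sphere_coord 1)"
    "proj I3 I1 = scalar (1 / 2) * (sphere_coord 0 + - (scalar \<i> * sphere_coord 1))"
    "proj I1 I4 = scalar (1 / 2) * (sphere_coord 2 + scalar \<i> * sphere_coord 3)"
    "proj I4 I1 = scalar (1 / 2) * (sphere_coord 2 + - (scalar \<i> * sphere_coord 3))"
    "proj I1 I1 = scalar (1 / 2) * (sphere_coord 4 + 1)"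
    using half scalar_half[of "proj I1 I1"] by (simp_all add: sphere_coord_def i)
  then have gens: "proj I1 I3 \<in> ?R" "proj I3 I1 \<in> ?R" "proj I1 I4 \<in> ?R" "proj I4 I1 \<in> ?R" "proj I1 I1 \<in> ?R"
    by (simp_all only: add mult scalar coord neg one)
  have "proj I3 I3 = 1 + - proj I1 I1"
    using x_coord_unit by (simp add: proj_def v_coord_eq coord_star_hom coord_star_star algebra_simps)
  moreover have "proj I1 I2 = 0" "proj I2 I1 = 0" "proj I3 I4 = 0" "proj I4 I3 = 0" "proj I2 I2 = proj I1 I1"
    "proj I4 I4 = proj I3 I3" "proj I2 I3 = proj I4 I1" "proj I3 I2 = proj I1 I4"
    "proj I2 I4 = - proj I3 I1" "proj I4 I2 = - proj I1 I3"
    by (simp_all add: proj_def v_coord_eq coord_star_hom coord_star_star algebra_simps)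
  ultimately show ?thesis
    by (cases i; cases j; simp only: gens neg add one zero)
qed

text \<open>The five coordinates are combinations of entries of \<open>p\<close>, and conversely.\<close>

lemma A_S4_carrier_one: "carrier (A_S4 1) = range (Rep_coord \<circ> sphere_eval.eval)"
proof
  interpret S7: star_algebra "A_S7 1" by (rule A_S7_star_algebra(1)) simp
  note S4 = unital_subalgebraD[OF A_S4_subalgebra(1)[of 1]]
  define B where "B = {x. Rep_coord x \<in> carrier (A_S4 1)}"
  have proj: "proj i j \<in> B" for i j
    by (simp add: B_def Rep_coord_proj A_S4_subalgebra(3))
  have ops: "x + y \<in> B" "x * y \<in> B" "scalar c * x \<in> B" if "x \<in> B" "y \<in> B" for x y c
    using that S4(3)[of "Rep_coord x"] S4(6,7)[of "Rep_coord x" "Rep_coord y"]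
    unfolding B_def mem_Collect_eq Rep_coord_scalar by (simp_all add: Rep_coord_hom(1,2))
  have one: "1 \<in> B"
    using S4(4) by (simp add: B_def Rep_coord_hom)
  have neg: "- x \<in> B" if "x \<in> B" for x
    using ops(3)[OF that that, of "- 1"] by (simp add: scalar_hom)
  have diff: "x - y \<in> B" if "x \<in> B" "y \<in> B" for x y
    using ops(1)[OF that(1) neg[OF that(2)]] by simp
  have "2 * x \<in> B" if "x \<in> B" for x
    using ops(1)[OF that that] by simp
  then have coord: "sphere_coord k \<in> B" for k
    unfolding sphere_coord_def using proj ops diff one by auto
  have "sphere_eval.eval f \<in> B" for f
  proof (induction f rule: poly5_induct)
    case (const c)
    show ?case using ops(3)[OF one one, of c] by (simp add: sphere_eval.eval_const)
  qed (simp_all add: sphere_eval.eval_add sphere_eval.eval_mult sphere_eval.eval_var ops coord)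
  then show "range (Rep_coord \<circ> sphere_eval.eval) \<subseteq> carrier (A_S4 1)"
    by (auto simp: B_def)
  then have sub: "range (Rep_coord \<circ> sphere_eval.eval) \<subseteq> carrier (A_S7 1)"
    using S4(1) by auto
  have "unital_subalgebra (range (Rep_coord \<circ> sphere_eval.eval)) (A_S7 1)"
  proof (rule S7.unital_subalgebraI[OF sub])
    have "\<one>\<^bsub>A_S7 1\<^esub> = (Rep_coord \<circ> sphere_eval.eval) 1"
      by (simp add: sphere_eval.eval_one Rep_coord_hom)
    then show "\<one>\<^bsub>A_S7 1\<^esub> \<in> range (Rep_coord \<circ> sphere_eval.eval)"
      by blast
    fix x y c
    assume "x \<in> range (Rep_coord \<circ> sphere_eval.eval)"
    then obtain f where f: "x = (Rep_coord \<circ> sphere_eval.eval) f" by blast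
    have "c \<odot>\<^bsub>A_S7 1\<^esub> x = (Rep_coord \<circ> sphere_eval.eval) (const c * f)"
      by (simp add: f sphere_eval.eval_mult sphere_eval.eval_const Rep_coord_scalar)
    then show "c \<odot>\<^bsub>A_S7 1\<^esub> x \<in> range (Rep_coord \<circ> sphere_eval.eval)"
      by blast
    assume "y \<in> range (Rep_coord \<circ> sphere_eval.eval)"
    then obtain g where g: "y = (Rep_coord \<circ> sphere_eval.eval) g" by blast
    have "x \<oplus>\<^bsub>A_S7 1\<^esub> y = (Rep_coord \<circ> sphere_eval.eval) (f + g)"
      "x \<otimes>\<^bsub>A_S7 1\<^esub> y = (Rep_coord \<circ> sphere_eval.eval) (f * g)"
      by (simp_all add: f g sphere_eval.eval_mult sphere_eval.eval_add Rep_coord_hom)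
    then show "x \<oplus>\<^bsub>A_S7 1\<^esub> y \<in> range (Rep_coord \<circ> sphere_eval.eval)"
      "x \<otimes>\<^bsub>A_S7 1\<^esub> y \<in> range (Rep_coord \<circ> sphere_eval.eval)"
      by blast+
  qed
  moreover have "{p_mat 1 i j |i j. True} \<subseteq> range (Rep_coord \<circ> sphere_eval.eval)"
  proof
    fix x assume "x \<in> {p_mat 1 i j |i j. True}"
    then obtain i j where "x = Rep_coord (proj i j)" by (auto simp: Rep_coord_proj)
    moreover obtain f where "proj i j = sphere_eval.eval f" using proj_in_range by blast
    ultimately have "x = (Rep_coord \<circ> sphere_eval.eval) f" by simp
    then show "x \<in> range (Rep_coord \<circ> sphere_eval.eval)" by blast
  qed
  ultimately show "carrier (A_S4 1) \<subseteq> range (Rep_coord \<circ> sphere_eval.eval)"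
    unfolding A_S4_def by (rule S7.generated_minimal)
qed

subsection \<open>Independence of the coordinates\<close>

text \<open>The character at \<open>hopf_point\<close> sends the coordinates to the point \<open>w\<close> below it, so it carries the evaluation in
  the coordinate ring to the evaluation at \<open>w\<close>.\<close>

lemma hopf_character_eval:
  assumes unit: "of_real r * of_real r + v * cnj v = complex_of_real d * of_real d"
    "of_real d * of_real d * (1 + k * cnj k) = 1"
    and f: "sphere_eval.eval f = 0"
    and w: "complex_of_real (w 0) + \<i> * of_real (w 1) = 2 * of_real r * of_real d * cnj k"
      "complex_of_real (w 2) + \<i> * of_real (w 3) = - 2 * of_real r * v" "w 4 = 2 * r * r - 1"
  shows "complex_eval.eval (\<lambda>k. complex_of_real (w k)) f = 0"
proof -
  \<comment> \<open>The choice of a representative is harmless as the character vanishes on the ideal.\<close>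
  define phi where "phi x = hopf_character d r k v (SOME g. x = coord g)" for x
  have chi: "phi (coord g) = hopf_character d r k v g" for g
  proof -
    have "coord g = coord (SOME h. coord g = coord h)"
      by (rule someI) simp
    then have "g - (SOME h. coord g = coord h) \<in> sp_ideal 1"
      by (simp only: coord_eq_iff)
    from hopf_character_sp_ideal[OF unit this] show ?thesis
      by (simp add: phi_def character_diff)
  qed
  have neg: "hopf_character d r k v (- g) = - hopf_character d r k v g" for g
    using character_diff[of _ 0 g] by (simp add: character_zero)
  have add: "phi (x + y) = phi x + phi y" for x y
    by (cases x; cases y; simp only: coord_plus chi character_add)
  have mult: "phi (x * y) = phi x * phi y" for x y
    by (cases x; cases y; simp only: coord_times chi character_mult)
  have uminus: "phi (- x) = - phi x" for x
    by (cases x; simp only: coord_uminus chi neg)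
  have diff: "phi (x - y) = phi x - phi y" for x y
    by (cases x; cases y; simp only: coord_minus chi character_diff)
  have const: "phi (scalar c) = c" "phi 1 = 1" for c
    by (simp_all only: scalar_def one_coord_def chi character_const character_one)
  note hom = add mult uminus diff const
  have phi_x: "phi (x_coord i) = hopf_point d r k v i I4" "phi (coord_star (x_coord i)) = cnj (hopf_point d r k v i I4)" for i
    unfolding star_x_coord by (simp_all add: x_coord_def chi hopf_character_T hopf_character_ST)
  have two: "phi 2 = 2"
    using add[of 1 1] by (simp add: const)
  define k' where "k' = k"
  have coord: "phi (sphere_coord k) = complex_of_real (w k)" for k
  proof -
    have "phi (proj I1 I3) = of_real r * of_real d * cnj k'" "phi (proj I3 I1) = of_real r * of_real d * k'"
      "phi (proj I1 I4) = - of_real r * v" "phi (proj I4 I1) = - of_real r * cnj v"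
      "phi (proj I1 I1) = of_real r * of_real r"
      by (simp_all add: proj_def v_coord_eq coord_star_hom coord_star_star hom phi_x k'_def)
    then have phi_coords: "phi (sphere_coord 0) = of_real r * of_real d * cnj k' + of_real r * of_real d * k'"
      "phi (sphere_coord 1) = - \<i> * (of_real r * of_real d * cnj k' - of_real r * of_real d * k')"
      "phi (sphere_coord 2) = - of_real r * v + - of_real r * cnj v"
      "phi (sphere_coord 3) = - \<i> * (- of_real r * v - - of_real r * cnj v)"
      "phi (sphere_coord 4) = 2 * (of_real r * of_real r) - 1"
      by (simp_all only: sphere_coord_def hom two if_True refl simp_thms, simp_all add: hom two)
    have parts: "w 0 = 2 * r * d * Re k'" "w 1 = - 2 * r * d * Im k'" "w 2 = - 2 * r * Re v" "w 3 = - 2 * r * Im v"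
      using w(1,2) by (simp_all add: complex_eq_iff k'_def)
    have "phi (sphere_coord 0) = complex_of_real (w 0)" "phi (sphere_coord 1) = complex_of_real (w 1)"
      "phi (sphere_coord 2) = complex_of_real (w 2)" "phi (sphere_coord 3) = complex_of_real (w 3)"
      "phi (sphere_coord 4) = complex_of_real (w 4)"
      unfolding phi_coords parts w(3) by (simp_all add: complex_eq_iff)
    then show ?thesis
      using exhaust_5[of k] by metis
  qed
  have phi_eval: "phi (sphere_eval.eval f) = complex_eval.eval (\<lambda>k. complex_of_real (w k)) f" for f
    by (induction f rule: poly5_induct)
      (simp_all add: sphere_eval.eval_add sphere_eval.eval_mult sphere_eval.eval_var sphere_eval.eval_const
        complex_eval.eval_add complex_eval.eval_mult complex_eval.eval_var complex_eval.eval_const hom coord)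
  from this[of f] show ?thesis
    using diff[of 0 0] by (simp add: f)
qed

text \<open>The parameters of \<open>hopf_point\<close> over a given \<open>w\<close> are found by solving \<open>r\<^sup>2 = p\<^sub>1\<^sub>1\<close>, then \<open>p\<^sub>1\<^sub>4 = - r v\<close>, and then
  \<open>p\<^sub>1\<^sub>3 = r d k\<^sup>*\<close>; that the resulting matrix is unitary is the equation of the sphere.\<close>

lemma sphere_eval_kernel: "sphere_eval.eval f = 0 \<longleftrightarrow> f \<in> sphere_ideal"
proof
  assume "f \<in> sphere_ideal"
  then show "sphere_eval.eval f = 0"
    by (rule eval_sphere_ideal[OF sphere_coord_unit sphere_eval.poly5_evaluation_axioms])
next
  assume f: "sphere_eval.eval f = 0"
  show "f \<in> sphere_ideal"
  proof (rule vanishing_on_sphere)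
    fix w :: "5 \<Rightarrow> real"
    assume unit: "(\<Sum>k\<in>UNIV. w k ^ 2) = 1" and "w 4 > -1"
    define r where "r = sqrt ((1 + w 4) / 2)"
    define v where "v = - ((complex_of_real (w 2) + \<i> * of_real (w 3)) / (2 * of_real r))"
    define d where "d = sqrt (r ^ 2 + cmod v ^ 2)"
    define k where "k = cnj ((complex_of_real (w 0) + \<i> * of_real (w 1)) / (2 * of_real r * of_real d))"
    have r: "r > 0" "r ^ 2 = (1 + w 4) / 2"
      using \<open>w 4 > -1\<close> by (simp_all add: r_def)
    have d: "d > 0" "d ^ 2 = r ^ 2 + cmod v ^ 2"
      using r by (simp_all add: d_def add_pos_nonneg)
    have norm: "cmod (complex_of_real a + \<i> * of_real b) ^ 2 = a ^ 2 + b ^ 2"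
      "cmod (complex_of_real a - \<i> * of_real b) ^ 2 = a ^ 2 + b ^ 2" for a b
      by (simp_all add: cmod_power2)
    have v: "4 * r ^ 2 * cmod v ^ 2 = w 2 ^ 2 + w 3 ^ 2"
      using r(1) by (simp add: v_def norm_divide norm power_divide power_mult_distrib norm_mult)
    have k: "4 * r ^ 2 * d ^ 2 * cmod k ^ 2 = w 0 ^ 2 + w 1 ^ 2"
      using r(1) d(1) by (simp add: k_def norm_divide norm power_divide power_mult_distrib norm_mult)
    have "4 * r ^ 2 * (d ^ 2 * (1 + cmod k ^ 2)) = 4 * r ^ 2 * r ^ 2 + 4 * r ^ 2 * cmod v ^ 2 + 4 * r ^ 2 * d ^ 2 * cmod k ^ 2"
      by (simp add: d(2) algebra_simps)
    also have "\<dots> = (1 + w 4) ^ 2 + (w 2 ^ 2 + w 3 ^ 2) + (w 0 ^ 2 + w 1 ^ 2)"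
      unfolding v k unfolding r(2) by (simp add: power2_eq_square)
    also have "\<dots> = 4 * r ^ 2 * 1"
      using unit unfolding sum_5 r(2) by (simp add: power2_eq_square algebra_simps)
    finally have "d ^ 2 * (1 + cmod k ^ 2) = 1"
      using r \<open>w 4 > -1\<close> by auto
    then have "complex_of_real (d ^ 2 * (1 + cmod k ^ 2)) = 1"
      by simp
    then have unit_k: "of_real d * of_real d * (1 + k * cnj k) = (1 :: complex)"
      by (simp add: power2_eq_square flip: complex_norm_square)
    have "complex_of_real (r ^ 2 + cmod v ^ 2) = complex_of_real (d ^ 2)"
      using d by simp
    then have unit_v: "of_real r * of_real r + v * cnj v = complex_of_real d * of_real d"
      by (simp add: power2_eq_square flip: complex_norm_square)
    show "complex_eval.eval (\<lambda>k. complex_of_real (w k)) f = 0"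
    proof (rule hopf_character_eval[OF unit_v unit_k f])
      show "complex_of_real (w 0) + \<i> * of_real (w 1) = 2 * of_real r * of_real d * cnj k"
        using r d by (simp add: k_def)
      show "complex_of_real (w 2) + \<i> * of_real (w 3) = - 2 * of_real r * v"
        using r by (simp add: v_def)
      show "w 4 = 2 * r * r - 1"
        using r(2) by (simp add: power2_eq_square)
    qed
  qed
qed

lemma A_S4_classical: "star_isomorphic (A_S4 1) Pol_S4"
proof -
  let ?h = "Rep_coord \<circ> sphere_eval.eval"
  have A_S4: "mult (A_S4 1) = mult (A_Sp 1)" "add (A_S4 1) = add (A_Sp 1)" "one (A_S4 1) = one (A_Sp 1)"
    "c \<odot>\<^bsub>A_S4 1\<^esub> x = c \<odot>\<^bsub>A_Sp 1\<^esub> x" "star (A_S4 1) = star (A_Sp 1)" for c x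
    by (simp_all add: A_S4_def)
  have "star_isomorphic (A_S4 1) (star_quot poly5_alg sphere_ideal)"
  proof (rule star_isomorphic_quot[OF sphere_star_ideal])
    show "carrier (A_S4 1) = ?h ` carrier poly5_alg"
      unfolding A_S4_carrier_one by (simp add: poly5_alg_def)
    show "?h x = ?h y \<longleftrightarrow> x \<ominus>\<^bsub>poly5_alg\<^esub> y \<in> sphere_ideal" for x y
      using sphere_eval_kernel[of "x - y"]
      by (simp add: poly5_alg_def Rep_coord_inject sphere_eval.eval_diff)
  qed (simp_all add: A_S4 poly5_alg_def Rep_coord_hom Rep_coord_scalar Rep_coord_star[symmetric]
      coord_star_eval sphere_eval.eval_one sphere_eval.eval_add sphere_eval.eval_mult sphere_eval.eval_const
      del: Rep_coord_hom(2), simp_all add: Rep_coord_hom)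
  then show ?thesis
    by (simp only: Pol_S4_def sphere_ideal_def)
qed

theorem proposition3:
  shows "(\<forall>q::real. q \<noteq> 0 \<longrightarrow>
            star_algebra (A_S7 q) \<and>
            (\<forall>i k. v_mat q i k \<in> carrier (A_S7 q)) \<and>
            mat_mult (A_S7 q) (mat_star (A_S7 q) (v_mat q)) (v_mat q) = mat_one (A_S7 q) \<and>
            mat_star (A_S7 q) (p_mat q) = p_mat q \<and>
            mat_mult (A_S7 q) (p_mat q) (p_mat q) = p_mat q \<and>
            unital_subalgebra (carrier (A_S4 q)) (A_S7 q))
         \<and> is_deformation A_S4 Pol_S4"
  unfolding is_deformation_def
  by (intro conjI allI impI A_S7_star_algebra(1) v_mat_closed v_mat_isometry p_mat_projection
      A_S4_subalgebra(1,2) A_S4_classical)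

end
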